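(* Let $n,d,r$ be integers with $n,d\geq 2$ and $1\leq r\leq d-1$. Let $q=p^n$, where $p$ is a prime such that $p^n \equiv 1 \pmod d$ and \[ p\geq \frac{(2n-1)^2 rd^2}{(d-r)^2}. \] Let $H$ be the subgroup of $\mathbb{F}_q^*$ with index $d$ and let $D$ be a union of $r$ cosets of $H$ in $\mathbb{F}_q^*$. If $f:\mathbb{F}_q \to \mathbb{F}_q$ is a function such that $\mathcal{D}_f \subseteq D$ and $|\mathcal{D}_f|\leq \frac{q+1}{2}$, then there are $a,b \in \mathbb{F}_q$ and an integer $0 \leq j \leq n-1$ such that \[ f(x)=a x^{p^j}+b \qquad \text{for all } x\in\mathbb{F}_q. \]
   Context: $\mathbb{F}_q$ denotes the finite field with $q$ elements and $\mathbb{F}_q^*=\mathbb{F}_q\setminus\{0\}$ its multiplicative group. For a function $f:\mathbb{F}_q\to\mathbb{F}_q$, the set of directions determined by $f$ is \[ \mathcal{D}_f=\left\{\frac{f(x)-f(y)}{x-y} : x,y\in\mathbb{F}_q,\ x\neq y\right\}\subseteq \mathbb{F}_q . \] *)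

theory Defs
  imports
    Complex_Main
    "HOL-Library.Cardinality"
    "HOL-Computational_Algebra.Primes"
    "HOL-Number_Theory.Cong"
    "HOL-Algebra.Coset"
begin

text \<open>
  The field with \<open>q\<close> elements is a type of class \<open>field\<close> and \<open>finite\<close> whose cardinality is \<open>q\<close>.
  Its multiplicative group is viewed as a HOL-Algebra group, so that subgroups and cosets are
  the library's.
\<close>

definition mult_group :: "'a::field monoid" where
  "mult_group = \<lparr>carrier = UNIV - {0}, mult = (*), one = 1\<rparr>"

lemma mult_group_simps:
  "carrier (mult_group :: 'a::field monoid) = UNIV - {0}"
  "(x::'a) \<otimes>\<^bsub>mult_group\<^esub> y = x * y"
  "\<one>\<^bsub>mult_group\<^esub> = (1::'a)"
  by (simp_all add: mult_group_def)

lemma group_mult_group: "group (mult_group :: 'a::field monoid)"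
proof (rule groupI)
  fix x :: 'a
  assume "x \<in> carrier mult_group"
  then show "\<exists>y\<in>carrier mult_group. y \<otimes>\<^bsub>mult_group\<^esub> x = \<one>\<^bsub>mult_group\<^esub>"
    by (intro bexI[of _ "inverse x"]) (auto simp: mult_group_simps)
qed (auto simp: mult_group_simps)

definition directions :: "('a::field \<Rightarrow> 'a) \<Rightarrow> 'a set" where
  "directions f = {(f x - f y) / (x - y) | x y. x \<noteq> y}"

definition is_union_of_cosets :: "('g, 'm) monoid_scheme \<Rightarrow> nat \<Rightarrow> 'g set \<Rightarrow> 'g set \<Rightarrow> bool" where
  "is_union_of_cosets G r H D \<longleftrightarrow> (\<exists>C. C \<subseteq> rcosets\<^bsub>G\<^esub> H \<and> finite C \<and> card C = r \<and> D = \<Union>C)"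

end

theory Submission
  imports Defs "HOL-Computational_Algebra.Polynomial"
begin

text \<open>
  First, at most \<open>(q + 1) / 2\<close> directions force \<open>f\<close> to be additive up to a constant.  The Redei
  polynomial \<open>R\<^sub>y(X)\<close>, the product of the \<open>X + x y - f x\<close> over all \<open>x\<close>, equals \<open>X ^ q\<close> plus terms
  of degree at most \<open>card (directions f)\<close>.  It divides \<open>(R\<^sub>y - X ^ q + X) R\<^sub>y'\<close>, so by comparing
  degrees \<open>R\<^sub>y' = 0\<close> for every direction \<open>y\<close>.  Hence the product of the
  \<open>(x' - x) Y - (f x' - f x)\<close> over \<open>x' \<noteq> x\<close>, as a polynomial in \<open>Y\<close>, does not depend on \<open>x\<close>: all
  lines of slope \<open>y\<close> that meet the graph do so in the same number of points, a power of \<open>p\<close>.  For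
  the directions of least multiplicity the intercepts form a coset of a subgroup, and these
  directions are so numerous that, by counting lines through a point, the graph is closed under
  \<open>P + Q - P'\<close>.

  Second, let \<open>F\<close> be the normalisation of \<open>f\<close> with \<open>F 0 = 0\<close> and \<open>F 1 = 1\<close>.  For every \<open>x\<close> the
  elements \<open>(t + F x) / (t + x)\<close>, with \<open>t\<close> in the prime field, lie in a union of \<open>r\<close> cosets
  of \<open>H\<close>.  Unless \<open>F x\<close> lies in a proper subfield or is a conjugate of \<open>x\<close>, this is excluded by
  Stepanov's method, with a choice of auxiliary polynomials (based on the digits of multiples of
  \<open>(q - 1) / d\<close>) that is sharp enough for the stated bound on \<open>p\<close>.  Since the field is not a
  union of \<open>2 n - 1\<close> proper subspaces over the prime field, \<open>F\<close> is a power of Frobenius.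
\<close>

section \<open>Polynomials over finite fields\<close>

lemma of_nat_card_finite_ring: "of_nat CARD('a) = (0 :: 'a::{ring_1,finite})"
proof -
  have "(\<Sum>x\<in>(UNIV::'a set). x + 1) = (\<Sum>x\<in>UNIV. x)"
    by (rule sum.reindex_bij_witness[of _ "\<lambda>x. x - 1" "\<lambda>x. x + 1"]) auto
  thus ?thesis by (simp add: sum.distrib)
qed

lemma two_le_card_field: "2 \<le> CARD('a::{field,finite})"
proof -
  have "card {0, 1::'a} \<le> CARD('a)" by (rule card_mono) auto
  thus ?thesis by simp
qed

lemma finite_field_pow_card_minus_1:
  fixes x :: "'a::{field,finite}"
  assumes "x \<noteq> 0"
  shows "x ^ (CARD('a) - 1) = 1"
proof -
  define P where "P = (\<Prod>y\<in>UNIV - {0::'a}. y)"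
  have "P = (\<Prod>y\<in>UNIV-{0}. x * y)" unfolding P_def
    by (rule prod.reindex_bij_witness[of _ "\<lambda>y. x * y" "\<lambda>y. y / x"]) (use assms in auto)
  also have "\<dots> = x ^ (CARD('a) - 1) * P"
    by (simp add: prod.distrib P_def)
  finally show ?thesis by (auto simp: P_def)
qed

lemma finite_field_pow_card: "x ^ CARD('a) = (x :: 'a::{field,finite})"
proof (cases "x = 0")
  case False
  have "CARD('a) = Suc (CARD('a) - 1)" using two_le_card_field[where 'a = 'a] by simp
  thus ?thesis using finite_field_pow_card_minus_1[OF False] by (metis mult.right_neutral power_Suc)
qed simp

section \<open>Products of linear factors\<close>

lemma order_prod_linear:
  fixes c :: "'b \<Rightarrow> 'a::idom"
  assumes "finite A"
  shows "Polynomial.order z (\<Prod>x\<in>A. [:- c x, 1:]) = card {x\<in>A. c x = z}"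
  using assms
proof (induction A rule: finite_induct)
  case (insert a A)
  have ne: "(\<Prod>x\<in>A. [:- c x, 1:]) \<noteq> 0" using insert by auto
  have "Polynomial.order z [:- c a, 1:] = (if c a = z then 1 else 0)"
    using order_power_n_n[of z 1] by (auto intro: order_0I)
  moreover have "{x \<in> insert a A. c x = z} =
      (if c a = z then insert a {x\<in>A. c x = z} else {x\<in>A. c x = z})" by auto
  moreover have "Polynomial.order z ([:- c a, 1:] * (\<Prod>x\<in>A. [:- c x, 1:])) =
     Polynomial.order z [:- c a, 1:] + Polynomial.order z (\<Prod>x\<in>A. [:- c x, 1:])"
    by (rule order_mult) (use ne in \<open>simp del: mult_pCons_left\<close>)
  ultimately show ?case using insert by simp
qed simp

lemma degree_prod_linear:
  "finite A \<Longrightarrow> degree (\<Prod>x\<in>A. [:c x, 1::'a::idom:]) = card A"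
  by (subst degree_prod_eq_sum_degree) auto

lemma lead_coeff_prod_linear:
  "lead_coeff (\<Prod>x\<in>A. [:c x, 1::'a::idom:]) = 1"
  by (simp add: lead_coeff_prod)

lemma prod_linear_dvd:
  fixes P :: "'a::idom poly"
  assumes "finite A" and "\<And>z. z \<in> A \<Longrightarrow> poly P z = 0"
  shows "(\<Prod>z\<in>A. [:- z, 1:]) dvd P"
  using assms
proof (induction A arbitrary: P rule: finite_induct)
  case (insert a A)
  from insert.prems have "[:- a, 1:] dvd P" by (simp add: poly_eq_0_iff_dvd)
  then obtain Q where Q: "P = [:- a, 1:] * Q" by (elim dvdE)
  have "(\<Prod>z\<in>A. [:- z, 1:]) dvd Q"
  proof (rule insert.IH)
    fix z assume z: "z \<in> A"
    with insert.prems[of z] have "poly P z = 0" by simp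
    with z insert.hyps show "poly Q z = 0" by (auto simp: Q)
  qed
  hence "[:- a, 1:] * (\<Prod>z\<in>A. [:- z, 1:]) dvd [:- a, 1:] * Q" by (intro mult_dvd_mono dvd_refl)
  moreover have "(\<Prod>z\<in>insert a A. [:- z, 1:]) = [:- a, 1:] * (\<Prod>z\<in>A. [:- z, 1:])"
    using insert.hyps by (rule prod.insert)
  ultimately show ?case by (simp only: Q)
qed simp

lemma prod_linear_UNIV:
  "(\<Prod>z\<in>UNIV. [:- z, 1:]) = monom 1 CARD('a) - monom (1::'a::{field,finite}) 1"
proof (rule poly_eqI_degree_lead_coeff[where A = UNIV and n = "CARD('a)"])
  note c2 = two_le_card_field[where 'a = 'a]
  show "degree (\<Prod>z\<in>UNIV. [:- z, 1::'a:]) \<le> CARD('a)"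
    by (simp add: degree_prod_linear)
  show "degree (monom 1 CARD('a) - monom (1::'a) 1) \<le> CARD('a)"
    by (rule degree_diff_le) (use c2 in \<open>auto simp: degree_monom_eq\<close>)
  show "poly.coeff (\<Prod>z\<in>UNIV. [:- z, 1:]) CARD('a) =
      poly.coeff (monom 1 CARD('a) - monom (1::'a) 1) CARD('a)"
    using lead_coeff_prod_linear[of uminus "UNIV :: 'a set"] c2
    by (simp add: degree_prod_linear)
  show "poly (\<Prod>z\<in>UNIV. [:- z, 1:]) z = poly (monom 1 CARD('a) - monom 1 1) z" for z :: 'a
    by (auto simp: poly_prod poly_monom finite_field_pow_card intro!: prod_zero)
qed simp

text \<open>The logarithmic derivative \<open>P'/P\<close> of a product of linear factors has simple poles only.\<close>

lemma prod_linear_dvd_mult_pderiv: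
  fixes c :: "'b \<Rightarrow> 'a::idom"
  assumes "finite A" and "\<And>x. x \<in> A \<Longrightarrow> poly L (c x) = 0"
  shows "(\<Prod>x\<in>A. [:- c x, 1:]) dvd L * pderiv (\<Prod>x\<in>A. [:- c x, 1:])"
proof -
  have "(\<Prod>x\<in>A. [:- c x, 1:]) dvd L * prod (\<lambda>x. [:- c x, 1:]) (A - {a})" if "a \<in> A" for a
  proof -
    have "[:- c a, 1:] dvd L" using assms(2)[OF that] by (simp add: poly_eq_0_iff_dvd)
    hence "[:- c a, 1:] * prod (\<lambda>x. [:- c x, 1:]) (A - {a}) dvd
        L * prod (\<lambda>x. [:- c x, 1:]) (A - {a})" by (rule mult_dvd_mono) simp
    thus ?thesis using prod.remove[OF assms(1) that, of "\<lambda>x. [:- c x, 1:]"] by simp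
  qed
  thus ?thesis
    by (auto simp: pderiv_prod sum_distrib_left pderiv_pCons intro!: dvd_sum)
qed

lemma degree_pderiv_le: "degree (pderiv P) \<le> degree P - 1" for P :: "'a::idom poly"
  by (rule degree_le) (simp add: coeff_pderiv coeff_eq_0)

text \<open>For \<open>i > 0\<close> some nonzero \<open>g\<close> has
  \<open>g ^ i \<noteq> 1\<close>, because \<open>X ^ i - 1\<close> has at most
  \<open>i < q - 1\<close> roots. Replacing \<open>y\<close> by \<open>g y\<close> multiplies the
  sum by \<open>g ^ i\<close>.\<close>

lemma sum_power_finite_field:
  assumes "i < CARD('a) - 1"
  shows "(\<Sum>y\<in>(UNIV :: 'a::{field,finite} set). y ^ i) = 0"
proof (cases "i = 0")
  case True
  thus ?thesis by (simp add: of_nat_card_finite_ring)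
next
  case False
  define P where "P = monom (1::'a) i - 1"
  have deg: "degree P \<le> i" unfolding P_def
    by (rule degree_diff_le) (auto simp: degree_monom_eq)
  have "poly.coeff P i = 1" using False by (simp add: P_def)
  hence "P \<noteq> 0" by auto
  from card_poly_roots_bound[OF this] have "card {x. poly P x = 0} \<le> i" using deg by simp
  hence "card {x. poly P x = 0} < card (UNIV - {0::'a})"
    using assms by (simp add: card_Diff_singleton)
  hence "\<not> UNIV - {0} \<subseteq> {x. poly P x = 0}"
    by (meson card_mono finite not_le)
  then obtain g :: 'a where g: "g \<noteq> 0" "g ^ i \<noteq> 1" by (auto simp: P_def poly_monom)
  define s where "s = (\<Sum>y\<in>(UNIV :: 'a set). y ^ i)"
  have "s = (\<Sum>y\<in>UNIV. (g * y) ^ i)" unfolding s_def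
    by (rule sum.reindex_bij_witness[of _ "\<lambda>y. g * y" "\<lambda>y. y / g"]) (use g in auto)
  also have "\<dots> = g ^ i * s" by (simp add: s_def power_mult_distrib sum_distrib_left)
  finally have "(g ^ i - 1) * s = 0" by (simp add: algebra_simps)
  thus ?thesis using g by (simp add: s_def)
qed

lemma sum_poly_finite_field:
  fixes P :: "'a::{field,finite} poly"
  assumes "degree P \<le> CARD('a) - 1"
  shows "(\<Sum>y\<in>UNIV. poly P y) = - poly.coeff P (CARD('a) - 1)"
proof -
  have c1: "CARD('a) \<ge> 1" by (simp add: Suc_leI)
  have top: "(\<Sum>y\<in>(UNIV::'a set). y ^ (CARD('a) - 1)) = -1"
  proof -
    note c2 = two_le_card_field[where 'a = 'a]
    have "(\<Sum>y\<in>(UNIV::'a set). y ^ (CARD('a) - 1)) = (\<Sum>y\<in>UNIV - {0::'a}. y ^ (CARD('a) - 1))"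
      by (rule sum.mono_neutral_right) (use c2 in auto)
    also have "\<dots> = (\<Sum>y\<in>UNIV - {0::'a}. 1)" by (intro sum.cong refl finite_field_pow_card_minus_1) auto
    also have "\<dots> = of_nat CARD('a) - 1" using c1 by (simp add: card_Diff_singleton of_nat_diff)
    finally show ?thesis by (simp add: of_nat_card_finite_ring)
  qed
  have "poly P y = (\<Sum>i\<le>CARD('a) - 1. poly.coeff P i * y ^ i)" for y
    by (subst poly_as_sum_of_monoms'[OF assms, symmetric]) (simp add: poly_sum poly_monom)
  hence "(\<Sum>y\<in>UNIV. poly P y) = (\<Sum>y\<in>UNIV. \<Sum>i\<le>CARD('a) - 1. poly.coeff P i * y ^ i)"
    by simp
  also have "\<dots> = (\<Sum>i\<le>CARD('a) - 1. poly.coeff P i * (\<Sum>y\<in>UNIV. y ^ i))"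
    by (subst sum.swap) (simp add: sum_distrib_left)
  also have "\<dots> = (\<Sum>i\<in>{CARD('a) - 1}. poly.coeff P i * (\<Sum>y\<in>UNIV. y ^ i))"
    by (rule sum.mono_neutral_right) (auto simp: sum_power_finite_field)
  finally show ?thesis using top by simp
qed

lemma coeff_mult_top:
  fixes P Q :: "'a::comm_semiring_0 poly"
  assumes "degree P \<le> a" and "degree Q \<le> b"
  shows "poly.coeff (P * Q) (a + b) = poly.coeff P a * poly.coeff Q b"
proof -
  have "poly.coeff (P * Q) (a + b) = (\<Sum>i\<le>a + b. poly.coeff P i * poly.coeff Q (a + b - i))"
    by (rule coeff_mult)
  also have "\<dots> = (\<Sum>i\<in>{a}. poly.coeff P i * poly.coeff Q (a + b - i))"
  proof (rule sum.mono_neutral_right)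
    have "poly.coeff P i = 0 \<or> poly.coeff Q (a + b - i) = 0" if "i \<noteq> a" for i
    proof (cases "i < a")
      case True
      hence "degree Q < a + b - i" using assms(2) by linarith
      thus ?thesis by (simp add: coeff_eq_0)
    next
      case False
      hence "degree P < i" using assms(1) that by linarith
      thus ?thesis by (simp add: coeff_eq_0)
    qed
    thus "\<forall>i\<in>{..a + b} - {a}. poly.coeff P i * poly.coeff Q (a + b - i) = 0" by fastforce
  qed auto
  finally show ?thesis by simp
qed

text \<open>The product has total degree \<open>card A\<close> in \<open>X\<close> and
  \<open>y\<close>. The family \<open>\<sigma>\<close> lists its \<open>X\<close>-coefficients as
  polynomials in \<open>y\<close>, which avoids bivariate polynomials.\<close>

lemma coeff_prod_linear_family:
  fixes a b :: "'b \<Rightarrow> 'a::comm_ring_1"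
  assumes "finite A"
  shows "\<exists>\<sigma>. (\<forall>i y. poly (\<sigma> i) y = poly.coeff (\<Prod>x\<in>A. [:a x * y + b x, 1:]) i) \<and>
             (\<forall>i j. i + j > card A \<longrightarrow> poly.coeff (\<sigma> i) j = 0)"
  using assms
proof (induction A rule: finite_induct)
  case empty
  show ?case
    by (rule exI[of _ "\<lambda>i. if i = 0 then 1 else 0"]) (auto simp: coeff_1)
next
  case (insert x A)
  then obtain \<sigma> where \<sigma>: "\<And>i y. poly (\<sigma> i) y = poly.coeff (\<Prod>x\<in>A. [:a x * y + b x, 1:]) i"
    "\<And>i j. i + j > card A \<Longrightarrow> poly.coeff (\<sigma> i) j = 0" by blast
  define \<tau> where "\<tau> i = [:b x, a x:] * \<sigma> i + (if i = 0 then 0 else \<sigma> (i - 1))" for i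
  have "poly (\<tau> i) y = poly.coeff (\<Prod>x\<in>insert x A. [:a x * y + b x, 1:]) i" for i y
    using insert.hyps by (cases i) (auto simp: \<tau>_def \<sigma>(1) algebra_simps)
  moreover have "poly.coeff (\<tau> i) j = 0" if "i + j > card (insert x A)" for i j
    using that insert.hyps by (cases i; cases j) (auto simp: \<tau>_def \<sigma>(2))
  ultimately show ?case by blast
qed

section \<open>Frobenius in a field of \<open>p ^ n\<close> elements\<close>

locale prime_power_field =
  fixes field_type :: "'a::{field,finite} itself" and p n :: nat
  assumes prime_p: "prime p" and card_field: "CARD('a) = p ^ n"
begin

lemma p_pos: "0 < p"
  using prime_p by (rule prime_gt_0_nat)

lemma CHAR_eq: "CHAR('a) = p"
proof -
  have dvd: "CHAR('a) dvd p ^ n"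
    using of_nat_card_finite_ring[where 'a = 'a] card_field
    by (simp only: of_nat_eq_0_iff_char_dvd)
  moreover have "p ^ n > 0" using prime_p by (simp add: prime_gt_0_nat)
  ultimately have "CHAR('a) > 0" by (meson dvd_pos_nat)
  hence "prime CHAR('a)" by (rule prime_CHAR_semidom)
  thus ?thesis using dvd prime_p by (meson prime_dvd_power primes_dvd_imp_eq)
qed

lemma of_nat_eq_0_iff: "of_nat k = (0::'a) \<longleftrightarrow> p dvd k"
  by (simp add: of_nat_eq_0_iff_char_dvd CHAR_eq)

lemma frob_add: "(x + y :: 'a) ^ (p ^ i) = x ^ (p ^ i) + y ^ (p ^ i)"
  by (rule freshmans_dream') (auto simp: CHAR_eq prime_p)

lemma frob_add_poly: "(P + Q :: 'a poly) ^ (p ^ i) = P ^ (p ^ i) + Q ^ (p ^ i)"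
  by (rule freshmans_dream') (auto simp: CHAR_eq prime_p)

lemma n_pos: "n > 0"
proof (rule ccontr)
  assume "\<not> n > 0"
  hence "CARD('a) = 1" using card_field by simp
  hence "card {0, 1::'a} \<le> 1" by (metis card_mono finite subset_UNIV)
  thus False by simp
qed

lemma pow_card: "x ^ (p ^ n) = (x::'a)"
  using finite_field_pow_card[of x] card_field by simp

lemma pow_card_minus_1: "x \<noteq> 0 \<Longrightarrow> x ^ (p ^ n - 1) = (1::'a)"
proof -
  assume x: "x \<noteq> 0"
  have "p ^ n = Suc (p ^ n - 1)" using prime_p by (simp add: prime_gt_0_nat)
  hence "x * x ^ (p ^ n - 1) = x" using pow_card[of x] by (metis power_Suc)
  thus ?thesis using x by simp
qed

end

section \<open>Few directions force additivity\<close>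

locale function_on_field = prime_power_field field_type p n
  for field_type :: "'a::{field,finite} itself" and p n :: nat +
  fixes f :: "'a \<Rightarrow> 'a"
begin

lemma card_Compl: "card (- A :: 'a set) = p ^ n - card A"
  by (simp add: Compl_eq_Diff_UNIV card_Diff_subset card_field)

text \<open>Its roots are the intercepts of the lines of slope \<open>y\<close> through points of
  the graph; the multiplicity of a root is the number of graph points on the line.\<close>

definition redei :: "'a \<Rightarrow> 'a poly" where
  "redei y = (\<Prod>x\<in>UNIV. [:- (f x - x * y), 1:])"

text \<open>Geometrically, this counts the graph points on the line of slope \<open>y\<close>
  through \<open>(x, f x)\<close>.\<close>

definition line_mult :: "'a \<Rightarrow> 'a \<Rightarrow> nat" where
  "line_mult x y = card {x'. f x' - x' * y = f x - x * y}"

text \<open>The roots are the slopes of the secants through \<open>(x, f x)\<close>. The factors are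
  not normalised, so that the value at \<open>y\<close> is the derivative of \<open>redei y\<close>
  at the intercept \<open>f x - x * y\<close>.\<close>

definition slopes :: "'a \<Rightarrow> 'a poly" where
  "slopes x = (\<Prod>x'\<in>-{x}. [:f x - f x', x' - x:])"

lemma degree_redei: "degree (redei y) = p ^ n"
  unfolding redei_def using degree_prod_linear[of UNIV "\<lambda>x. - (f x - x * y)"] card_field by simp

lemma coeff_redei_top: "poly.coeff (redei y) (p ^ n) = 1"
  using lead_coeff_prod_linear[of "\<lambda>x. - (f x - x * y)" UNIV] degree_redei[of y]
  by (simp add: redei_def)

lemma redei_nonzero: "redei y \<noteq> 0"
  using coeff_redei_top[of y] by auto

lemma order_redei: "Polynomial.order (f x - x * y) (redei y) = line_mult x y"
  unfolding redei_def line_mult_def by (subst order_prod_linear[OF finite]) simp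

lemma poly_redei_root: "poly (redei y) (f x - x * y) = 0"
  unfolding redei_def poly_prod by (rule prod_zero) (auto intro!: exI[of _ x])

lemma line_mult_eq:
  "line_mult x y = Suc (card {x'\<in>-{x}. (f x' - f x) / (x' - x) = y})"
proof -
  have "{x'. f x' - x' * y = f x - x * y} = insert x {x'\<in>-{x}. (f x' - f x) / (x' - x) = y}"
    by (auto simp: field_simps)
  thus ?thesis unfolding line_mult_def by simp
qed

lemma line_mult_pos: "line_mult x y > 0"
  by (simp add: line_mult_eq)

lemma directions_eq: "directions f = {y. \<exists>x. line_mult x y \<ge> 2}"
proof safe
  fix y assume "y \<in> directions f"
  then obtain u x where "y = (f u - f x) / (u - x)" "u \<noteq> x" by (auto simp: directions_def)
  hence "{x'\<in>-{x}. (f x' - f x) / (x' - x) = y} \<noteq> {}" by auto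
  hence "card {x'\<in>-{x}. (f x' - f x) / (x' - x) = y} > 0" by (simp add: card_gt_0_iff)
  thus "\<exists>x. 2 \<le> line_mult x y" by (intro exI[of _ x]) (simp add: line_mult_eq)
next
  fix y x assume "2 \<le> line_mult x y"
  hence "card {x'\<in>-{x}. (f x' - f x) / (x' - x) = y} > 0" by (simp add: line_mult_eq)
  then obtain x' where "x' \<noteq> x" "(f x' - f x) / (x' - x) = y" by (auto simp: card_gt_0_iff)
  thus "y \<in> directions f" by (auto simp: directions_def)
qed

lemma line_mult_not_direction: "y \<notin> directions f \<Longrightarrow> line_mult x y = 1"
proof -
  assume "y \<notin> directions f"
  hence "\<not> 2 \<le> line_mult x y" by (auto simp: directions_eq)
  thus ?thesis using line_mult_pos[of x y] by linarith
qed

text \<open>Without a secant of slope \<open>y\<close> the intercepts are pairwise distinct, so they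
  exhaust the field.\<close>

lemma redei_not_direction:
  assumes "y \<notin> directions f"
  shows "redei y = monom 1 (p ^ n) - monom 1 1"
proof -
  have "inj (\<lambda>x. f x - x * y)"
  proof (rule injI)
    fix x x' assume eq: "f x - x * y = f x' - x' * y"
    show "x = x'"
    proof (rule ccontr)
      assume ne: "x \<noteq> x'"
      have "f x - f x' = y * (x - x')" using eq by (simp add: algebra_simps)
      hence y: "y = (f x - f x') / (x - x')" using ne by (metis eq_divide_eq right_minus_eq)
      have "(f x - f x') / (x - x') \<in> directions f"
        unfolding directions_def using ne by blast
      thus False using y assms by metis
    qed
  qed
  hence "bij (\<lambda>x. f x - x * y)" using finite_UNIV_inj_surj by (metis bij_def finite)
  hence "redei y = (\<Prod>z\<in>UNIV. [:- z, 1:])" unfolding redei_def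
    by (rule prod.reindex_bij_betw[where g = "\<lambda>z. [:- z, 1:]"])
  thus ?thesis unfolding prod_linear_UNIV card_field .
qed

lemma sum_line_mult: "(\<Sum>y\<in>UNIV. line_mult x y - 1) = p ^ n - 1"
proof -
  have "(\<Sum>y\<in>UNIV. line_mult x y - 1) =
      (\<Sum>y\<in>UNIV. card {x'\<in>-{x}. (f x' - f x) / (x' - x) = y})" by (simp add: line_mult_eq)
  also have "\<dots> = card (-{x})"
  proof -
    let ?s = "\<lambda>x'. (f x' - f x) / (x' - x)"
    have "(\<Sum>y\<in>UNIV. \<Sum>x'\<in>{x'\<in>-{x}. ?s x' = y}. 1::nat) = (\<Sum>x'\<in>-{x}. 1)"
      by (rule sum.group) auto
    thus ?thesis unfolding card_eq_sum .
  qed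
  finally show ?thesis by (simp add: card_Compl)
qed

text \<open>At this root the product rule leaves only the term in which the linear factor of
  \<open>x\<close> is differentiated.\<close>

lemma pderiv_redei_root: "poly (pderiv (redei y)) (f x - x * y) = poly (slopes x) y"
proof -
  define l where "l x' = [:- (f x' - x' * y), 1:]" for x'
  have l: "poly (l x') (f x - x * y) = (f x - f x') + (x' - x) * y" for x'
    by (simp add: l_def algebra_simps)
  have "redei y = l x * prod l (-{x})"
    unfolding redei_def l_def[symmetric] Compl_eq_Diff_UNIV by (rule prod.remove) auto
  hence "poly (pderiv (redei y)) (f x - x * y) =
      poly (l x * pderiv (prod l (-{x})) + prod l (-{x}) * pderiv (l x)) (f x - x * y)"
    by (simp add: pderiv_mult)
  also have "\<dots> = poly (prod l (-{x})) (f x - x * y)"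
  proof -
    have "pderiv (l x) = 1" by (simp add: l_def pderiv_pCons)
    thus ?thesis by (simp add: l)
  qed
  also have "\<dots> = poly (slopes x) y"
    by (simp add: poly_prod l slopes_def mult.commute)
  finally show ?thesis .
qed

lemma slopes_eq:
  "slopes x = smult (\<Prod>x'\<in>-{x}. x' - x) (\<Prod>x'\<in>-{x}. [:- ((f x' - f x) / (x' - x)), 1:])"
proof -
  have "slopes x = (\<Prod>x'\<in>-{x}. smult (x' - x) [:- ((f x' - f x) / (x' - x)), 1:])"
    unfolding slopes_def by (rule prod.cong) (auto simp: field_simps)
  thus ?thesis by (simp only: prod_smult)
qed

lemma order_slopes: "Polynomial.order y (slopes x) = line_mult x y - 1"
  unfolding slopes_eq by (subst order_smult) (auto simp: order_prod_linear line_mult_eq)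

lemma degree_slopes: "degree (slopes x) = p ^ n - 1"
  unfolding slopes_eq
  using degree_prod_linear[of "-{x}" "\<lambda>x'. - ((f x' - f x) / (x' - x))"]
  by (auto simp: card_Compl)

lemma coeff_slopes:
  assumes "odd p"
  shows "poly.coeff (slopes x) (p ^ n - 1) = -1"
proof -
  let ?Q = "\<Prod>x'\<in>-{x}. [:- ((f x' - f x) / (x' - x)), 1:]"
  have "degree ?Q = p ^ n - 1" by (subst degree_prod_linear) (auto simp: card_Compl)
  moreover have "lead_coeff ?Q = 1" by (rule lead_coeff_prod_linear)
  ultimately have "poly.coeff (slopes x) (p ^ n - 1) = (\<Prod>x'\<in>-{x}. x' - x)"
    unfolding slopes_eq by simp
  also have "\<dots> = (\<Prod>x'\<in>-{x}. x - x')"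
  proof -
    have "even (card (-{x}))"
      using assms n_pos by (simp add: card_Compl)
    moreover have "(\<Prod>x'\<in>-{x}. - (x - x')) = (- 1) ^ card (-{x}) * (\<Prod>x'\<in>-{x}. x - x')"
      by (rule prod_uminus)
    ultimately show ?thesis by simp
  qed
  also have "\<dots> = -1"
  proof -
    \<comment> \<open>Wilson's theorem comes from the zero function: 1 is not among its directions,
      and its \<open>slopes\<close> take at 1 the product of all nonzero elements as value.\<close>
    interpret z: function_on_field field_type p n "\<lambda>_. 0" ..
    have "1 \<notin> directions (\<lambda>_::'a. 0::'a)" by (auto simp: directions_def)
    hence "z.redei 1 = monom 1 (p ^ n) - monom 1 1" by (rule z.redei_not_direction)
    hence "poly (pderiv (z.redei 1)) (0 - (-x) * 1) = -1"
      using card_field of_nat_card_finite_ring[where 'a = 'a]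
      by (simp add: pderiv_diff pderiv_monom poly_monom)
    hence "poly (z.slopes (- x)) 1 = -1" by (simp only: z.pderiv_redei_root)
    hence "(\<Prod>x'\<in>-{-x}. x' + x) = -1" by (simp add: z.slopes_def poly_prod)
    moreover have "(\<Prod>x'\<in>-{-x}. x' + x) = (\<Prod>x'\<in>-{x}. x - x')"
      by (rule prod.reindex_bij_witness[of _ uminus uminus]) auto
    ultimately show ?thesis by simp
  qed
  finally show ?thesis .
qed

lemma coeff_redei_eq_poly:
  obtains \<sigma> where "\<And>i y. poly (\<sigma> i) y = poly.coeff (redei y) i"
    and "\<And>i j. i + j > p ^ n \<Longrightarrow> poly.coeff (\<sigma> i) j = 0"
proof -
  obtain \<sigma> where \<sigma>: "\<forall>i y. poly (\<sigma> i) y = poly.coeff (\<Prod>x\<in>UNIV. [:x * y + - f x, 1:]) i"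
    "\<forall>i j. i + j > CARD('a) \<longrightarrow> poly.coeff (\<sigma> i) j = 0"
    using coeff_prod_linear_family[of UNIV "\<lambda>x. x" "\<lambda>x. - f x"] by auto
  show ?thesis by (rule that[of \<sigma>]) (use \<sigma> card_field in \<open>auto simp: redei_def\<close>)
qed

section \<open>The gap in the Redei polynomial and its derivative\<close>

lemma card_not_directions: "card (- directions f) = p ^ n - card (directions f)"
  by (simp add: card_Compl)

lemma card_directions_pos: "card (directions f) > 0"
proof -
  have "(f 1 - f 0) / (1 - 0) \<in> directions f"
    unfolding directions_def by (intro CollectI exI[of _ 1] exI[of _ 0]) auto
  thus ?thesis by (auto simp: card_gt_0_iff)
qed

text \<open>With \<open>N\<close> directions, the coefficient of \<open>X ^ i\<close> is a
  polynomial in \<open>y\<close> of degree at most \<open>q - i\<close> that vanishes at the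
  \<open>q - N\<close> slopes outside the directions. For \<open>i > N\<close> these are too many
  roots.\<close>

lemma coeff_redei_eq_0:
  assumes "card (directions f) < i" "i < p ^ n"
  shows "poly.coeff (redei y) i = 0"
proof -
  obtain \<sigma> where \<sigma>: "\<And>i y. poly (\<sigma> i) y = poly.coeff (redei y) i"
    "\<And>i j. i + j > p ^ n \<Longrightarrow> poly.coeff (\<sigma> i) j = 0" using coeff_redei_eq_poly by blast
  have i1: "1 < i" using assms(1) card_directions_pos by simp
  have "\<sigma> i = 0"
  proof (rule poly_eqI_degree[of "- directions f"])
    show "poly (\<sigma> i) y = poly 0 y" if "y \<in> - directions f" for y
      using that i1 assms(2) by (simp add: \<sigma>(1) redei_not_direction)
    have "degree (\<sigma> i) \<le> p ^ n - i" by (rule degree_le) (auto intro: \<sigma>(2))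
    thus "degree (\<sigma> i) < card (- directions f)" using assms by (simp add: card_not_directions)
    show "degree 0 < card (- directions f)" using assms by (simp add: card_not_directions)
  qed
  thus ?thesis using \<sigma>(1)[of i y] by simp
qed

text \<open>Since \<open>X ^ q\<close> and \<open>X\<close> agree on the field,
  \<open>redei_low y + monom 1 1\<close> still vanishes at every intercept.\<close>

definition redei_low :: "'a \<Rightarrow> 'a poly" where
  "redei_low y = redei y - monom 1 (p ^ n)"

lemma degree_redei_low: "degree (redei_low y) \<le> card (directions f)"
proof (rule degree_le, safe)
  fix i assume i: "card (directions f) < i"
  consider "i < p ^ n" | "i = p ^ n" | "i > p ^ n" by linarith
  thus "poly.coeff (redei_low y) i = 0"
    by cases (use i in \<open>auto simp: redei_low_def coeff_redei_eq_0 coeff_redei_top coeff_eq_0 degree_redei\<close>)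
qed

lemma pderiv_redei: "pderiv (redei y) = pderiv (redei_low y)"
  using of_nat_card_finite_ring[where 'a = 'a] card_field
  by (simp add: redei_low_def pderiv_diff pderiv_monom)

lemma redei_low_root: "poly (redei_low y + monom 1 1) (f x - x * y) = 0"
  by (simp add: redei_low_def poly_redei_root poly_monom pow_card)

lemma redei_dvd: "redei y dvd (redei_low y + monom 1 1) * pderiv (redei y)"
  unfolding redei_def[of y] by (rule prod_linear_dvd_mult_pderiv) (simp_all only: finite redei_low_root)

lemma pderiv_redei_double_root:
  assumes "line_mult x y \<ge> 2"
  shows "poly (pderiv (redei y)) (f x - x * y) = 0"
proof -
  have "Polynomial.order y (slopes x) > 0" using assms by (simp add: order_slopes)
  thus ?thesis by (metis order_0I pderiv_redei_root less_numeral_extra(3))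
qed

text \<open>Otherwise the derivative of \<open>redei y\<close> would be -1, although
  \<open>redei y\<close> has a multiple root for a direction \<open>y\<close>.\<close>

lemma redei_low_plus_X_nonzero:
  assumes "y \<in> directions f"
  shows "redei_low y + monom 1 1 \<noteq> 0"
proof
  assume eq: "redei_low y + monom 1 1 = 0"
  hence "pderiv (redei y) + 1 = 0"
    using pderiv_add[of "redei_low y" "monom 1 1"] by (simp add: pderiv_redei pderiv_monom)
  hence "pderiv (redei y) = -1" by (simp add: add_eq_0_iff2)
  moreover obtain x where "line_mult x y \<ge> 2" using assms by (auto simp: directions_eq)
  ultimately show False using pderiv_redei_double_root[of x y] by simp
qed

lemma degree_redei_low_plus_X:
  "degree (redei_low y + monom 1 1) \<le> card (directions f)"
proof (rule degree_add_le)
  show "degree (redei_low y) \<le> card (directions f)" by (rule degree_redei_low)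
  show "degree (monom (1::'a) 1) \<le> card (directions f)"
    using card_directions_pos by (simp add: degree_monom_eq)
qed

text \<open>If the derivative were nonzero, the multiple of \<open>redei y\<close> in
  \<open>redei_dvd\<close> would be nonzero of degree at most \<open>N + (N - 1)\<close>. This is
  below \<open>q\<close> if \<open>2 N \<le> q\<close>; if \<open>2 N = q + 1\<close>, the vanishing
  coefficient of \<open>X ^ N\<close> lowers the degree further.\<close>

lemma pderiv_redei_eq_0:
  assumes "y \<in> directions f" and "2 * card (directions f) \<le> p ^ n + 1"
    and "2 * card (directions f) \<noteq> p ^ n + 1 \<or> poly.coeff (redei y) (card (directions f)) = 0"
  shows "pderiv (redei y) = 0"
proof (rule ccontr)
  let ?N = "card (directions f)"
  assume ne: "pderiv (redei y) \<noteq> 0"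
  have q2: "2 \<le> p ^ n" using two_le_card_field[where 'a = 'a] card_field by simp
  have "degree (redei y) \<le> degree ((redei_low y + monom 1 1) * pderiv (redei y))"
    using redei_dvd ne redei_low_plus_X_nonzero[OF assms(1)] by (intro dvd_imp_degree_le) auto
  also have "\<dots> \<le> ?N + degree (pderiv (redei y))"
    by (rule order_trans[OF degree_mult_le]) (intro add_right_mono degree_redei_low_plus_X)
  finally have deg: "p ^ n \<le> ?N + degree (pderiv (redei y))" by (simp add: degree_redei)
  have d1: "degree (pderiv (redei y)) \<le> degree (redei_low y) - 1"
    unfolding pderiv_redei by (rule degree_pderiv_le)
  show False
  proof (cases "2 * ?N = p ^ n + 1")
    case False
    thus False using deg d1 degree_redei_low[of y] assms(2) card_directions_pos by linarith
  next
    case True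
    hence N: "?N < p ^ n" "1 < ?N" using q2 by linarith+
    have "poly.coeff (redei_low y) ?N = 0" using assms(3) True N by (simp add: redei_low_def)
    have "degree (redei_low y) \<noteq> ?N"
    proof
      assume d: "degree (redei_low y) = ?N"
      with \<open>poly.coeff (redei_low y) ?N = 0\<close> have "redei_low y = 0"
        by (metis leading_coeff_0_iff)
      with d N(2) show False by simp
    qed
    thus False using deg d1 degree_redei_low[of y] True N by linarith
  qed
qed

end

text \<open>Write \<open>R = (X - z) ^ m \<rho>\<close> and \<open>L = (X - z) K\<close>. Cancelling
  \<open>(X - z) ^ m\<close> and evaluating at \<open>z\<close> gives \<open>m K(z) = c\<close>, and
  \<open>K(z)\<close> is the derivative of \<open>L\<close> at \<open>z\<close>.\<close>

lemma multiplicity_at_root: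
  fixes R L :: "'a::idom poly"
  assumes "L * pderiv R = smult c R" and "poly L z = 0" and "R \<noteq> 0"
  shows "of_nat (Polynomial.order z R) * poly (pderiv L) z = c"
proof -
  define m where "m = Polynomial.order z R"
  obtain \<rho> where \<rho>: "R = [:- z, 1:] ^ m * \<rho>" "\<not> [:- z, 1:] dvd \<rho>"
    using order_decomp[OF assms(3), of z] by (auto simp: m_def)
  obtain K where K: "L = [:- z, 1:] * K" using assms(2) by (auto simp: poly_eq_0_iff_dvd elim: dvdE)
  have dR: "[:- z, 1:] * pderiv R = [:- z, 1:] ^ m * (smult (of_nat m) \<rho> + [:- z, 1:] * pderiv \<rho>)"
  proof (cases m)
    case 0
    thus ?thesis using \<rho> by simp
  next
    case (Suc k)
    have "pderiv ([:- z, 1:] ^ m) = smult (of_nat m) ([:- z, 1:] ^ k)"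
      unfolding Suc pderiv_power_Suc by (simp add: pderiv_pCons)
    thus ?thesis
      unfolding \<rho>(1) pderiv_mult by (simp add: Suc algebra_simps del: mult_pCons_left mult_pCons_right)
  qed
  have "[:- z, 1:] ^ m * (K * (smult (of_nat m) \<rho> + [:- z, 1:] * pderiv \<rho>)) = L * pderiv R"
    using dR unfolding K by (simp add: algebra_simps del: mult_pCons_left mult_pCons_right)
  also have "\<dots> = [:- z, 1:] ^ m * smult c \<rho>" using assms(1) \<rho>(1) by simp
  finally have "K * (smult (of_nat m) \<rho> + [:- z, 1:] * pderiv \<rho>) = smult c \<rho>"
    by (subst (asm) mult_left_cancel) simp_all
  hence "poly (K * (smult (of_nat m) \<rho> + [:- z, 1:] * pderiv \<rho>)) z = poly (smult c \<rho>) z" by simp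
  hence "poly K z * of_nat m * poly \<rho> z = c * poly \<rho> z" by simp
  moreover have "poly \<rho> z \<noteq> 0" using \<rho>(2) by (simp add: poly_eq_0_iff_dvd)
  moreover have "poly (pderiv L) z = poly K z"
    unfolding K pderiv_mult by (simp add: pderiv_pCons del: mult_pCons_left mult_pCons_right)
  ultimately show ?thesis by (simp add: m_def mult.commute)
qed

section \<open>The case of exactly \<open>(q + 1) / 2\<close> directions\<close>

context function_on_field
begin

lemma three_le_card: "odd p \<Longrightarrow> 3 \<le> p ^ n"
proof -
  assume "odd p"
  hence "odd (p ^ n)" by simp
  moreover have "2 \<le> p ^ n" using two_le_card_field[where 'a = 'a] card_field by simp
  ultimately show ?thesis by presburger
qed

lemma pderiv_redei_not_direction:
  assumes "y \<notin> directions f"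
  shows "pderiv (redei y) = -1"
proof -
  have "of_nat (p ^ n) = (0::'a)"
    using of_nat_card_finite_ring[where 'a = 'a] card_field by simp
  thus ?thesis unfolding redei_not_direction[OF assms]
    by (simp add: pderiv_diff pderiv_monom monom_0 one_pCons del: of_nat_power)
qed

text \<open>
  When exactly half of the slopes occur, both sides of \<open>redei_dvd\<close> may have equal
  degrees.  This equality then determines the multiplicities of all lines modulo \<open>p\<close> from the leading
  coefficient \<open>\<gamma>\<close> of \<open>redei_low\<close>, with a formula that also covers all other slopes.
\<close>

lemma slopes_plus_line_mult:
  assumes "2 * card (directions f) = p ^ n + 1" and "odd p"
  shows "2 * (poly (slopes x) y + of_nat (line_mult x y)) =
      poly.coeff (redei y) (card (directions f)) ^ 2"
proof -
  let ?N = "card (directions f)"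
  define \<gamma> where "\<gamma> = poly.coeff (redei y) ?N"
  define L where "L = redei_low y + monom 1 1"
  define z where "z = f x - x * y"
  note q3 = three_le_card[OF assms(2)]
  have N: "?N < p ^ n" "2 \<le> ?N" using assms(1) q3 by linarith+
  have \<gamma>_low: "poly.coeff (redei_low y) ?N = \<gamma>" using N by (simp add: redei_low_def \<gamma>_def)
  have Lz: "poly L z = 0" unfolding L_def z_def by (rule redei_low_root)
  have dL: "pderiv L = pderiv (redei y) + 1"
    unfolding L_def pderiv_add pderiv_redei by (simp add: pderiv_monom)
  have two_N: "2 * of_nat ?N = (1::'a)"
  proof -
    have "of_nat (2 * ?N) = (of_nat (p ^ n + 1) :: 'a)" using assms(1) by simp
    thus ?thesis using of_nat_card_finite_ring[where 'a = 'a] card_field by simp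
  qed
  have "poly (slopes x) y + of_nat (line_mult x y) = \<gamma> ^ 2 * of_nat ?N"
  proof (cases "y \<in> directions f")
    case False
    hence R: "redei y = monom 1 (p ^ n) - monom 1 1" by (rule redei_not_direction)
    hence "\<gamma> = 0" using N by (simp add: \<gamma>_def)
    moreover have "poly (slopes x) y = -1"
      unfolding pderiv_redei_root[symmetric] by (simp add: pderiv_redei_not_direction[OF False])
    ultimately show ?thesis using False by (simp add: line_mult_not_direction)
  next
    case True
    show ?thesis
    proof (cases "\<gamma> = 0")
      case \<gamma>: True
      hence R': "pderiv (redei y) = 0"
        using assms(1) True by (intro pderiv_redei_eq_0) (auto simp: \<gamma>_def)
      hence "poly (slopes x) y = 0" using pderiv_redei_root[of y x] by simp
      moreover have "of_nat (line_mult x y) * poly (pderiv L) z = 0"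
        unfolding order_redei[symmetric] z_def
        by (rule multiplicity_at_root) (use Lz R' redei_nonzero in \<open>auto simp: z_def\<close>)
      ultimately show ?thesis using \<gamma> by (simp add: dL R')
    next
      case False
      have L0: "L \<noteq> 0" unfolding L_def by (rule redei_low_plus_X_nonzero[OF True])
      have degL: "degree L \<le> ?N" unfolding L_def by (rule degree_redei_low_plus_X)
      have degR': "degree (pderiv (redei y)) \<le> ?N - 1"
        unfolding pderiv_redei using degree_pderiv_le[of "redei_low y"] degree_redei_low[of y]
        by linarith
      have cR': "poly.coeff (pderiv (redei y)) (?N - 1) = of_nat ?N * \<gamma>"
        unfolding pderiv_redei coeff_pderiv using N by (simp add: \<gamma>_low)
      have "of_nat ?N \<noteq> (0::'a)" using two_N by auto
      with False cR' have R'0: "pderiv (redei y) \<noteq> 0" by auto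
      obtain W where W: "L * pderiv (redei y) = redei y * W"
        using redei_dvd[of y] by (auto simp: L_def elim: dvdE)
      have W0: "W \<noteq> 0" using W L0 R'0 by auto
      \<comment> \<open>The left side of \<open>W\<close> has degree at most
        \<open>N + (N - 1) = q\<close>, so the cofactor \<open>W\<close> is constant.\<close>
      have "p ^ n + degree W = degree (redei y * W)"
        using redei_nonzero W0 by (simp add: degree_mult_eq degree_redei)
      also have "\<dots> = degree (L * pderiv (redei y))" by (simp add: W)
      also have "\<dots> = degree L + degree (pderiv (redei y))"
        using L0 R'0 by (rule degree_mult_eq)
      also have "\<dots> \<le> ?N + (?N - 1)" using degL degR' by simp
      finally have "degree W = 0" using assms(1) by linarith
      then obtain c where c: "W = [:c:]" by (elim degree_eq_zeroE)
      have eq: "L * pderiv (redei y) = smult c (redei y)" by (simp add: W c)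
      have "c = poly.coeff (smult c (redei y)) (p ^ n)" by (simp add: coeff_redei_top)
      also have "p ^ n = ?N + (?N - 1)" using assms(1) by linarith
      also have "poly.coeff (smult c (redei y)) (?N + (?N - 1)) =
          poly.coeff (L * pderiv (redei y)) (?N + (?N - 1))" by (simp add: eq)
      also have "\<dots> = poly.coeff L ?N * poly.coeff (pderiv (redei y)) (?N - 1)"
        using degL degR' by (rule coeff_mult_top)
      also have "poly.coeff L ?N = \<gamma>" using N by (simp add: L_def \<gamma>_low)
      finally have c_eq: "c = \<gamma> ^ 2 * of_nat ?N"
        unfolding cR' by (simp add: power2_eq_square)
      have m: "of_nat (line_mult x y) * poly (pderiv L) z = c"
        unfolding order_redei[symmetric] z_def
        by (rule multiplicity_at_root) (use eq Lz redei_nonzero in \<open>auto simp: z_def\<close>)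
      have dLz: "poly (pderiv L) z = poly (slopes x) y + 1"
        by (simp add: dL z_def pderiv_redei_root)
      \<comment> \<open>One factor in \<open>m\<close> is 1: either the multiplicity, or the
        derivative of \<open>L\<close>, since \<open>slopes x\<close> vanishes at \<open>y\<close>
        for a multiple line. Hence the product of the two factors is their sum minus 1.\<close>
      show ?thesis
      proof (cases "line_mult x y = 1")
        case True
        thus ?thesis using m dLz c_eq by simp
      next
        case False
        hence "2 \<le> line_mult x y" using line_mult_pos[of x y] by linarith
        hence "poly (slopes x) y = 0"
          using pderiv_redei_double_root[of x y] by (simp add: pderiv_redei_root)
        thus ?thesis using m dLz c_eq by simp
      qed
    qed
  qed
  hence "2 * (poly (slopes x) y + of_nat (line_mult x y)) = \<gamma> ^ 2 * (2 * of_nat ?N)" by simp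
  thus ?thesis by (simp only: two_N \<gamma>_def mult_1_right)
qed

text \<open>With \<open>N\<close> directions, the coefficient is a polynomial
  \<open>\<Gamma>\<close> in \<open>y\<close> of degree at most \<open>N - 1\<close>, and
  \<open>2 (N - 1) = q - 1\<close>. So the sum of its squared values is minus the square of its
  coefficient at \<open>N - 1\<close>, while \<open>slopes_plus_line_mult\<close> gives
  \<open>2 (1 - 1) = 0\<close>. Hence its degree is below \<open>N - 1\<close>, but it vanishes at
  the \<open>N - 1\<close> slopes outside the directions.\<close>

lemma coeff_redei_half:
  assumes "2 * card (directions f) = p ^ n + 1" and "odd p"
  shows "poly.coeff (redei y) (card (directions f)) = 0"
proof -
  let ?N = "card (directions f)"
  obtain \<sigma> where \<sigma>: "\<And>i y. poly (\<sigma> i) y = poly.coeff (redei y) i"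
    "\<And>i j. i + j > p ^ n \<Longrightarrow> poly.coeff (\<sigma> i) j = 0" using coeff_redei_eq_poly by blast
  define \<Gamma> where "\<Gamma> = \<sigma> ?N"
  note q3 = three_le_card[OF assms(2)]
  have N: "?N < p ^ n" "2 \<le> ?N" using assms(1) q3 by linarith+
  have deg: "degree \<Gamma> \<le> ?N - 1" unfolding \<Gamma>_def
    by (rule degree_le) (use assms(1) N in \<open>auto intro: \<sigma>(2)\<close>)
  have q1: "p ^ n - 1 = (?N - 1) + (?N - 1)" using assms(1) by linarith
  have "- (poly.coeff \<Gamma> (?N - 1) ^ 2) = - poly.coeff (\<Gamma> ^ 2) (CARD('a) - 1)"
    unfolding card_field q1 power2_eq_square by (subst coeff_mult_top[OF deg deg]) simp
  also have "\<dots> = (\<Sum>y\<in>UNIV. poly (\<Gamma> ^ 2) y)"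
  proof (rule sum_poly_finite_field[symmetric])
    have "degree (\<Gamma> ^ 2) \<le> degree \<Gamma> + degree \<Gamma>"
      unfolding power2_eq_square by (rule degree_mult_le)
    thus "degree (\<Gamma> ^ 2) \<le> CARD('a) - 1" unfolding card_field q1 using deg by linarith
  qed
  also have "\<dots> = (\<Sum>y\<in>UNIV. 2 * (poly (slopes 0) y + of_nat (line_mult 0 y)))"
    unfolding slopes_plus_line_mult[OF assms] by (simp add: \<Gamma>_def \<sigma>(1))
  also have "\<dots> = 2 * ((\<Sum>y\<in>UNIV. poly (slopes 0) y) + (\<Sum>y\<in>UNIV. of_nat (line_mult 0 y)))"
    by (simp add: sum_distrib_left[symmetric] sum.distrib)
  also have "(\<Sum>y\<in>UNIV. poly (slopes 0) y) = 1"
    using sum_poly_finite_field[of "slopes 0"] coeff_slopes[OF assms(2), of 0]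
    by (simp add: card_field degree_slopes)
  also have "(\<Sum>y\<in>UNIV. of_nat (line_mult 0 y)) = (-1::'a)"
  proof -
    have "(\<Sum>y\<in>UNIV. line_mult 0 y) = (\<Sum>y\<in>UNIV. (line_mult 0 y - 1) + 1)"
      by (rule sum.cong) (auto simp: line_mult_eq)
    also have "\<dots> = (p ^ n - 1) + p ^ n" by (simp only: sum.distrib sum_line_mult) (simp add: card_field)
    finally have "of_nat (\<Sum>y\<in>UNIV. line_mult 0 y) = (of_nat ((p ^ n - 1) + p ^ n) :: 'a)" by simp
    thus ?thesis using of_nat_card_finite_ring[where 'a = 'a] card_field q3
      by (simp add: of_nat_diff)
  qed
  finally have top: "poly.coeff \<Gamma> (?N - 1) = 0" by simp
  have "\<Gamma> = 0"
  proof (rule poly_eqI_degree[of "- directions f"])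
    show "poly \<Gamma> y = poly 0 y" if "y \<in> - directions f" for y
      using that N by (simp add: \<Gamma>_def \<sigma>(1) redei_not_direction)
    have "degree \<Gamma> < ?N - 1"
    proof (rule ccontr)
      assume "\<not> degree \<Gamma> < ?N - 1"
      hence d: "degree \<Gamma> = ?N - 1" using deg by simp
      hence "\<Gamma> = 0" using top by (metis leading_coeff_0_iff)
      thus False using d N by simp
    qed
    thus "degree \<Gamma> < card (- directions f)" using assms(1) by (simp add: card_not_directions)
    show "degree 0 < card (- directions f)" using N by (simp add: card_not_directions)
  qed
  thus ?thesis using \<sigma>(1)[of ?N y] by (simp add: \<Gamma>_def)
qed

end

section \<open>Constant multiplicity of parallel lines\<close>

locale few_directions = function_on_field field_type p n f
  for field_type :: "'a::{field,finite} itself" and p n :: nat and f :: "'a \<Rightarrow> 'a" +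
  assumes odd_p: "odd p" and few: "2 * card (directions f) \<le> p ^ n + 1"
begin

lemma pderiv_redei_direction: "y \<in> directions f \<Longrightarrow> pderiv (redei y) = 0"
  using pderiv_redei_eq_0[OF _ few] coeff_redei_half[OF _ odd_p] by blast

text \<open>Both values at \<open>y\<close> are values of the derivative of \<open>redei y\<close>,
  which is the constant 0 or -1. The degree \<open>q - 1\<close> lets agreement at all
  \<open>q\<close> points imply equality.\<close>

lemma slopes_const: "slopes x = slopes x'"
proof (rule poly_eqI_degree[of UNIV])
  show "poly (slopes x) y = poly (slopes x') y" for y
  proof (cases "y \<in> directions f")
    case True
    thus ?thesis by (simp add: pderiv_redei_root[symmetric] pderiv_redei_direction)
  next
    case False
    thus ?thesis by (simp add: pderiv_redei_root[symmetric] pderiv_redei_not_direction)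
  qed
qed (use two_le_card_field[where 'a = 'a] in \<open>simp_all add: degree_slopes card_field\<close>)

definition dir_mult :: "'a \<Rightarrow> nat" where
  "dir_mult y = line_mult 0 y"

lemma line_mult_const: "line_mult x y = dir_mult y"
  using order_slopes[of y x] order_slopes[of y 0] slopes_const[of x 0]
    line_mult_pos[of x y] line_mult_pos[of 0 y] by (simp add: dir_mult_def)

lemma dir_mult_ge_2_iff: "dir_mult y \<ge> 2 \<longleftrightarrow> y \<in> directions f"
  by (auto simp: directions_eq line_mult_const)

lemma dir_mult_not_direction: "y \<notin> directions f \<Longrightarrow> dir_mult y = 1"
  using line_mult_not_direction[of y 0] by (simp add: line_mult_const)

definition intercepts :: "'a \<Rightarrow> 'a set" where
  "intercepts y = range (\<lambda>x. f x - x * y)"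

lemma card_fiber: "s \<in> intercepts y \<Longrightarrow> card {x. f x - x * y = s} = dir_mult y"
  using line_mult_const[of _ y] by (auto simp: intercepts_def line_mult_def)

lemma card_intercepts: "dir_mult y * card (intercepts y) = p ^ n"
proof -
  have "(\<Sum>s\<in>intercepts y. \<Sum>x\<in>{x\<in>UNIV. f x - x * y = s}. 1::nat) = (\<Sum>x\<in>(UNIV::'a set). 1)"
    by (rule sum.group) (auto simp: intercepts_def)
  hence "(\<Sum>s\<in>intercepts y. card {x. f x - x * y = s}) = p ^ n" by (simp add: card_field)
  moreover have "(\<Sum>s\<in>intercepts y. card {x. f x - x * y = s}) = (\<Sum>s\<in>intercepts y. dir_mult y)"
    by (rule sum.cong) (auto simp: card_fiber)
  ultimately show ?thesis by (simp add: mult.commute)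
qed

lemma redei_eq_power:
  "redei y = (\<Prod>s\<in>intercepts y. [:- s, 1:]) ^ dir_mult y"
proof -
  have "(\<Prod>s\<in>intercepts y. \<Prod>x\<in>{x\<in>UNIV. f x - x * y = s}. [:- (f x - x * y), 1:]) = redei y"
    unfolding redei_def by (rule prod.group) (auto simp: intercepts_def)
  moreover have "(\<Prod>x\<in>{x\<in>UNIV. f x - x * y = s}. [:- (f x - x * y), 1:]) = [:- s, 1:] ^ dir_mult y"
    if "s \<in> intercepts y" for s
  proof -
    have "(\<Prod>x\<in>{x\<in>UNIV. f x - x * y = s}. [:- (f x - x * y), 1:]) =
        (\<Prod>x\<in>{x. f x - x * y = s}. [:- s, 1:])" by (rule prod.cong) auto
    thus ?thesis using card_fiber[OF that] by simp
  qed
  ultimately show ?thesis by (simp add: prod_power_distrib)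
qed

lemma dir_mult_prime_power: "\<exists>e\<le>n. dir_mult y = p ^ e"
proof -
  have "dir_mult y dvd p ^ n" using card_intercepts[of y] by (metis dvd_triv_left)
  thus ?thesis using prime_p by (simp add: divides_primepow_nat)
qed

lemma sum_dir_mult: "(\<Sum>y\<in>directions f. dir_mult y - 1) = p ^ n - 1"
proof -
  have "(\<Sum>y\<in>directions f. dir_mult y - 1) = (\<Sum>y\<in>UNIV. dir_mult y - 1)"
    by (rule sum.mono_neutral_left) (auto simp: dir_mult_not_direction)
  thus ?thesis using sum_line_mult[of 0] by (simp add: dir_mult_def)
qed

end

lemma pcompose_power: "(P ^ k) \<circ>\<^sub>p Q = (P \<circ>\<^sub>p Q) ^ k" for P Q :: "'a::comm_semiring_1 poly"
  by (induction k) (simp_all add: pcompose_mult pcompose_1)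

section \<open>Intercepts for the slopes of least multiplicity\<close>

context few_directions
begin

definition vanishing :: "'a \<Rightarrow> 'a poly" where
  "vanishing y = (\<Prod>s\<in>intercepts y. [:- s, 1:])"

lemma degree_vanishing: "degree (vanishing y) = card (intercepts y)"
  unfolding vanishing_def by (rule degree_prod_linear) simp

lemma poly_vanishing_eq_0_iff: "poly (vanishing y) z = 0 \<longleftrightarrow> z \<in> intercepts y"
  by (auto simp: vanishing_def poly_prod prod_zero_iff)

lemma redei_eq_vanishing: "redei y = vanishing y ^ dir_mult y"
  by (simp add: redei_eq_power vanishing_def)

lemma vanishing_dvd: "vanishing y dvd redei_low y + monom 1 1"
  unfolding vanishing_def
  by (rule prod_linear_dvd) (use redei_low_root in \<open>auto simp only: intercepts_def finite\<close>)

lemma card_intercepts_le: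
  assumes "y \<in> directions f"
  shows "card (intercepts y) \<le> card (directions f)"
  using dvd_imp_degree_le[OF vanishing_dvd redei_low_plus_X_nonzero[OF assms]]
    degree_redei_low_plus_X[of y] by (simp add: degree_vanishing)

text \<open>
  For a slope \<open>y\<close> of least multiplicity \<open>m\<close>, comparing degrees in the derivative of
  \<open>redei_low y + X = V W\<close> forces \<open>W\<close> to be a constant \<open>w\<close>, so that \<open>V ^ m - w V = X ^ q - X\<close>.
\<close>

lemma vanishing_equation:
  assumes y: "y \<in> directions f"
    and least: "\<And>y'. y' \<in> directions f \<Longrightarrow> dir_mult y \<le> dir_mult y'"
    and not_line: "dir_mult y \<noteq> p ^ n"
  obtains w where "w \<noteq> 0"
    "vanishing y ^ dir_mult y = monom 1 (p ^ n) - monom 1 1 + smult w (vanishing y)"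
proof -
  let ?N = "card (directions f)" and ?V = "vanishing y"
  define m where "m = dir_mult y"
  define t where "t = card (intercepts y)"
  have p3: "3 \<le> p" using prime_ge_2_nat[OF prime_p] odd_p by presburger
  obtain e where e: "e \<le> n" "m = p ^ e" using dir_mult_prime_power[of y] by (auto simp: m_def)
  have m2: "2 \<le> m" using y by (simp add: m_def dir_mult_ge_2_iff)
  have e0: "0 < e" using m2 e(2) by (cases e) auto
  have "e \<noteq> n" using e(2) not_line by (auto simp: m_def)
  hence en: "e < n" using e(1) by simp
  have mt: "m * t = p ^ n" using card_intercepts[of y] by (simp add: m_def t_def)
  also have "p ^ n = m * p ^ (n - e)" using e by (simp flip: power_add)
  finally have "t = p ^ (n - e)" using m2 by simp
  hence pt: "p dvd t" using en by simp
  have "p ^ 1 \<le> p ^ e" using e0 p3 by (intro power_increasing) auto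
  hence m3: "3 \<le> m" using p3 e(2) by simp
  have "?N * (m - 1) \<le> (\<Sum>y'\<in>directions f. dir_mult y' - 1)"
    using sum_bounded_below[of "directions f" "m - 1" "\<lambda>y'. dir_mult y' - 1"] least
    by (auto simp: m_def diff_le_mono)
  hence N: "?N * (m - 1) \<le> p ^ n - 1" by (simp only: sum_dir_mult)
  \<comment> \<open>The terms of the monic \<open>V\<close> below \<open>X ^ t\<close>. As
    \<open>m\<close> is a power of \<open>p\<close>, \<open>V ^ m = X ^ q + h ^ m\<close>, so
    \<open>m\<close> times the degree of \<open>h\<close> is at most \<open>N\<close>.\<close>
  define h where "h = ?V - monom 1 t"
  have low: "redei_low y = h ^ m"
  proof -
    have "redei y = (monom 1 t + h) ^ (p ^ e)" by (simp add: redei_eq_vanishing h_def e(2)[symmetric] m_def)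
    also have "\<dots> = monom 1 (p ^ n) + h ^ m"
      unfolding frob_add_poly by (simp add: monom_power mt[symmetric] e(2) mult.commute)
    finally show ?thesis by (simp add: redei_low_def)
  qed
  have degh: "m * degree h \<le> ?N"
    using degree_redei_low[of y] m2 by (cases "h = 0") (auto simp: low degree_power_eq)
  obtain W where W: "redei_low y + monom 1 1 = ?V * W" using vanishing_dvd[of y] by (elim dvdE)
  have W0: "W \<noteq> 0" using W redei_low_plus_X_nonzero[OF y] by auto
  have V0: "?V \<noteq> 0" using W redei_low_plus_X_nonzero[OF y] by auto
  have degW: "t + degree W \<le> ?N"
    using degree_redei_low_plus_X[of y] degree_mult_eq[OF V0 W0]
    unfolding W by (simp add: degree_vanishing t_def)
  have "m * (degree W + degree h) < m * t"
  proof -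
    \<comment> \<open>From \<open>m \<ge> 3\<close>, which comes from odd \<open>p\<close>, follows
      \<open>m + 1 \<le> 2 (m - 1)\<close>, so the bound on \<open>N (m - 1)\<close>
      applies.\<close>
    have "?N * (m + 1) \<le> ?N * (2 * (m - 1))" using m3 by (intro mult_left_mono) auto
    also have "\<dots> < 2 * p ^ n" using N two_le_card_field[where 'a = 'a] card_field by linarith
    finally have "?N * m + ?N < 2 * (m * t)" by (simp add: mt)
    moreover have "m * t + m * degree W \<le> m * ?N" using degW by (metis add_mult_distrib2 mult_le_mono2)
    ultimately show ?thesis using degh by (simp add: add_mult_distrib2 mult.commute)
  qed
  hence small: "degree W + degree h < t" by simp
  have dV: "pderiv ?V = pderiv h"
  proof -
    have "of_nat t = (0::'a)" using pt by (simp add: of_nat_eq_0_iff)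
    thus ?thesis by (simp add: h_def pderiv_diff pderiv_monom)
  qed
  have "pderiv (redei_low y + monom 1 1) = 1"
    using pderiv_redei_direction[OF y] by (simp add: pderiv_add pderiv_redei pderiv_monom)
  hence eq: "1 = ?V * pderiv W + W * pderiv h" unfolding W pderiv_mult dV by simp
  have dW: "pderiv W = 0"
  proof (rule ccontr)
    assume ne: "pderiv W \<noteq> 0"
    have "t \<le> degree (?V * pderiv W)"
      using degree_mult_eq[OF V0 ne] by (simp add: degree_vanishing t_def)
    also have "?V * pderiv W = 1 - W * pderiv h" using eq by (simp add: algebra_simps)
    also have "degree \<dots> \<le> degree W + degree h"
    proof (rule degree_diff_le)
      show "degree (W * pderiv h) \<le> degree W + degree h"
        using degree_mult_le[of W "pderiv h"] degree_pderiv_le[of h] by linarith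
    qed simp
    finally show False using small by simp
  qed
  hence unit: "W * pderiv h = 1" using eq by simp
  hence "pderiv h \<noteq> 0" by auto
  hence "degree W = 0" using degree_mult_eq[OF W0, of "pderiv h"] unit by simp
  then obtain w where w: "W = [:w:]" "w \<noteq> 0" using W0 by (auto elim: degree_eq_zeroE)
  have "redei_low y + monom 1 1 = smult w ?V" unfolding W w(1) by simp
  hence "?V ^ dir_mult y = monom 1 (p ^ n) - monom 1 1 + smult w ?V"
    by (simp add: redei_low_def redei_eq_vanishing algebra_simps)
  thus ?thesis using that w(2) by blast
qed

text \<open>Let \<open>c = z1 - z2\<close> and \<open>E(X) = V(X + c) - V(X)\<close>. In
  \<open>V ^ m - w V = X ^ q - X\<close> the right side is invariant under translation, which gives
  \<open>E ^ m = w E\<close>. So \<open>E\<close> is constant, and it vanishes at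
  \<open>z2\<close>.\<close>

lemma intercepts_translate:
  assumes y: "y \<in> directions f"
    and least: "\<And>y'. y' \<in> directions f \<Longrightarrow> dir_mult y \<le> dir_mult y'"
    and not_line: "dir_mult y \<noteq> p ^ n"
    and z: "z \<in> intercepts y" "z1 \<in> intercepts y" "z2 \<in> intercepts y"
  shows "z + (z1 - z2) \<in> intercepts y"
proof -
  define m V c where "m = dir_mult y" and "V = vanishing y" and "c = z1 - z2"
  obtain e where e: "m = p ^ e" using dir_mult_prime_power[of y] by (auto simp: m_def)
  have m2: "2 \<le> m" using y by (simp add: m_def dir_mult_ge_2_iff)
  obtain w where w: "w \<noteq> 0" "V ^ m = monom 1 (p ^ n) - monom 1 1 + smult w V"
    using vanishing_equation[OF y least not_line] by (metis V_def m_def)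
  define E where "E = V \<circ>\<^sub>p [:c, 1:] - V"
  have X: "monom (1::'a) k \<circ>\<^sub>p [:c, 1:] = [:c, 1:] ^ k" for k
    by (simp add: monom_altdef pcompose_smult pcompose_power pcompose_pCons)
  have Xq: "[:c, 1:] ^ (p ^ n) = monom 1 (p ^ n) + [:c:]"
  proof -
    have "[:c, 1:] = monom 1 1 + [:c:]" by (simp add: monom_altdef)
    hence "[:c, 1:] ^ (p ^ n) = monom 1 1 ^ (p ^ n) + [:c:] ^ (p ^ n)" by (simp only: frob_add_poly)
    thus ?thesis by (simp add: monom_power poly_const_pow pow_card)
  qed
  have "V ^ m + E ^ m = (V \<circ>\<^sub>p [:c, 1:]) ^ m"
    unfolding e frob_add_poly[symmetric] by (simp add: E_def)
  also have "\<dots> = (V ^ m) \<circ>\<^sub>p [:c, 1:]" by (simp add: pcompose_power)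
  also have "\<dots> = monom 1 (p ^ n) + [:c:] - (monom 1 1 + [:c:]) + smult w (V + E)"
  proof -
    have "[:c, 1:] = monom 1 1 + [:c:]" by (simp add: monom_altdef)
    thus ?thesis unfolding w(2) pcompose_add pcompose_diff pcompose_smult X Xq
      by (simp add: E_def)
  qed
  also have "\<dots> = V ^ m + smult w E" unfolding w(2) by (simp add: smult_add_right)
  finally have "E ^ m = smult w E" by simp
  hence "degree (E ^ m) = degree E" using w(1) by simp
  hence "degree E = 0" using m2 by (cases "E = 0") (auto simp: degree_power_eq)
  then obtain \<epsilon> where \<epsilon>: "E = [:\<epsilon>:]" by (elim degree_eq_zeroE)
  have polyE: "poly E u = poly V (u + c) - poly V u" for u
    by (simp add: E_def poly_pcompose add.commute)
  have V0: "poly V s = 0" if "s \<in> intercepts y" for s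
    using that unfolding V_def by (rule poly_vanishing_eq_0_iff[THEN iffD2])
  have "poly E z2 = 0" unfolding polyE using V0[OF z(2)] V0[OF z(3)] by (simp add: c_def)
  hence "poly E z = 0" by (simp add: \<epsilon>)
  hence "poly V (z + c) = 0" using V0[OF z(1)] by (simp add: polyE)
  thus ?thesis unfolding V_def c_def poly_vanishing_eq_0_iff .
qed

text \<open>Unless one line contains the graph, suppose that the point \<open>(u, v)\<close>
  completing a parallelogram is off the graph. Lines through it with a slope of least multiplicity
  \<open>m\<close> still carry \<open>m\<close> graph points each, and those whose slope is not a
  direction carry one. Counting these points makes the directions of least multiplicity rare,
  whereas the sum of all multiplicities makes them frequent.\<close>

lemma affine_additive: "f (x1 + x2) + f 0 = f x1 + f x2"
proof (cases "\<exists>y\<in>directions f. dir_mult y = p ^ n")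
  case True
  then obtain y where y: "dir_mult y = p ^ n" by auto
  have "p > 0" using prime_p by (rule prime_gt_0_nat)
  hence "card (intercepts y) = 1" using card_intercepts[of y] y by simp
  then obtain s where "intercepts y = {s}" by (auto simp: card_1_singleton_iff)
  hence "f x - x * y = s" for x by (auto simp: intercepts_def)
  hence "f x = s + x * y" for x by (metis add_diff_cancel_left' diff_add_cancel add.commute)
  thus ?thesis by (simp add: algebra_simps)
next
  case not_line: False
  let ?D = "directions f"
  define m where "m = Min (dir_mult ` ?D)"
  have "?D \<noteq> {}" using card_directions_pos by auto
  hence "m \<in> dir_mult ` ?D" unfolding m_def by (intro Min_in) auto
  then obtain y0 where y0: "y0 \<in> ?D" "dir_mult y0 = m" by auto
  have least: "m \<le> dir_mult y" if "y \<in> ?D" for y unfolding m_def using that by (intro Min_le) auto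
  have m2: "2 \<le> m" using y0 dir_mult_ge_2_iff by metis
  have p3: "3 \<le> p" using prime_ge_2_nat[OF prime_p] odd_p by presburger
  define A where "A = {y\<in>?D. dir_mult y = m}"
  define a b where "a = card A" and "b = card (?D - A)"
  have AD: "A \<subseteq> ?D" by (auto simp: A_def)
  have ab: "card ?D = a + b"
    using card_Diff_subset[of A ?D] card_mono[of ?D A] AD by (simp add: a_def b_def finite_subset)
  have a1: "1 \<le> a" using y0 by (auto simp: a_def A_def Suc_le_eq card_gt_0_iff)
  show ?thesis
  proof (rule ccontr)
    define u v where "u = x1 + x2" and "v = f x1 + f x2 - f 0"
    assume "f (x1 + x2) + f 0 \<noteq> f x1 + f x2"
    hence uv: "f u \<noteq> v" by (auto simp: u_def v_def)
    \<comment> \<open>The abscissae of the graph points on the line of slope \<open>y\<close>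
      through \<open>(u, v)\<close>.\<close>
    define T where "T y = {x. f x - x * y = v - u * y}" for y
    have T: "card (T y) = dir_mult y" if "y \<in> A \<union> - ?D" for y
    proof -
      have "v - u * y \<in> intercepts y"
      proof (cases "y \<in> ?D")
        case True
        hence y: "dir_mult y = m" using that by (auto simp: A_def)
        have mem: "f x - x * y \<in> intercepts y" for x by (simp add: intercepts_def)
        have "(f x1 - x1 * y) + ((f x2 - x2 * y) - (f 0 - 0 * y)) \<in> intercepts y"
          by (rule intercepts_translate[OF True _ _ mem mem mem])
            (use y least not_line True in auto)
        thus ?thesis by (simp add: u_def v_def algebra_simps)
      next
        case False
        hence "card (intercepts y) = CARD('a)"
          using card_intercepts[of y] by (simp add: dir_mult_not_direction card_field)
        hence "intercepts y = UNIV" by (intro card_subset_eq) auto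
        thus ?thesis by simp
      qed
      thus ?thesis unfolding T_def by (rule card_fiber)
    qed
    \<comment> \<open>Two lines through \<open>(u, v)\<close> share only that point, which is off
      the graph.\<close>
    have disj: "T y \<inter> T y' = {}" if "y \<noteq> y'" for y y'
    proof (rule ccontr)
      assume "T y \<inter> T y' \<noteq> {}"
      then obtain x where x: "f x - x * y = v - u * y" "f x - x * y' = v - u * y'"
        by (auto simp: T_def)
      have "(x - u) * y = f x - v" "(x - u) * y' = f x - v"
        using x by (simp_all add: algebra_simps)
      hence "(x - u) * (y - y') = 0" by (simp add: right_diff_distrib)
      hence "x = u" using that by simp
      thus False using x uv by simp
    qed
    have "(\<Sum>y\<in>A \<union> - ?D. dir_mult y) = (\<Sum>y\<in>A \<union> - ?D. card (T y))" using T by simp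
    also have "\<dots> = card (\<Union>y\<in>A \<union> - ?D. T y)"
      by (rule card_UN_disjoint[symmetric]) (simp_all add: disj)
    also have "\<dots> \<le> p ^ n" unfolding card_field[symmetric] by (rule card_mono) auto
    also have "(\<Sum>y\<in>A \<union> - ?D. dir_mult y) = (\<Sum>y\<in>A. dir_mult y) + (\<Sum>y\<in>- ?D. dir_mult y)"
      by (rule sum.union_disjoint) (use AD in auto)
    also have "(\<Sum>y\<in>A. dir_mult y) = a * m" by (simp add: A_def a_def)
    also have "(\<Sum>y\<in>- ?D. dir_mult y) = p ^ n - (a + b)"
      by (simp add: dir_mult_not_direction card_not_directions ab)
    finally have ineq1: "a * m \<le> a + b"
      using few two_le_card_field[where 'a = 'a] card_field ab by linarith
    \<comment> \<open>Multiplicities are powers of \<open>p\<close>, so one above \<open>m\<close>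
      is at least \<open>p m\<close>.\<close>
    have other: "p * m \<le> dir_mult y" if "y \<in> ?D - A" for y
    proof -
      obtain i j where ij: "m = p ^ i" "dir_mult y = p ^ j" 
        using dir_mult_prime_power[of y] dir_mult_prime_power[of y0] y0(2) by auto
      have "m < dir_mult y" using that least[of y] by (auto simp: A_def)
      hence "i < j" using ij p3 by (metis One_nat_def Suc_le_lessD Suc_leD numeral_3_eq_3 power_less_imp_less_exp)
      hence "p ^ Suc i \<le> p ^ j" using p3 by (intro power_increasing) auto
      thus ?thesis using ij by simp
    qed
    have "a * (m - 1) + b * (p * m - 1) \<le>
        (\<Sum>y\<in>A. dir_mult y - 1) + (\<Sum>y\<in>?D - A. dir_mult y - 1)"
    proof (rule add_mono)
      show "a * (m - 1) \<le> (\<Sum>y\<in>A. dir_mult y - 1)" by (simp add: A_def a_def)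
      show "b * (p * m - 1) \<le> (\<Sum>y\<in>?D - A. dir_mult y - 1)"
        using sum_bounded_below[of "?D - A" "p * m - 1" "\<lambda>y. dir_mult y - 1"] other
        by (auto simp: b_def diff_le_mono)
    qed
    also have "\<dots> = (\<Sum>y\<in>?D. dir_mult y - 1)"
      using sum.subset_diff[OF AD, of "\<lambda>y. dir_mult y - 1"] by simp
    also have "\<dots> < p ^ n"
      unfolding sum_dir_mult using two_le_card_field[where 'a = 'a] card_field by simp
    also have "p ^ n \<le> m * (a + b)"
      using card_intercepts[of y0] card_intercepts_le[OF y0(1)] y0(2) by (metis ab mult_le_mono2)
    finally have ineq2: "a * (m - 1) + b * (p * m - 1) < m * (a + b)" .
    \<comment> \<open>Substituting for \<open>m\<close> and \<open>p\<close> removes truncated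
      subtraction; what remains is \<open>b (2 k + 3) < a\<close> against
      \<open>a \<le> b\<close>.\<close>
    obtain k where k: "m = k + 2" using m2 by (metis add.commute le_Suc_ex)
    obtain l where l: "p = l + 3" using p3 by (metis add.commute le_Suc_ex)
    have "p * m - 1 = l * k + 2 * l + 3 * k + 5" by (simp add: k l algebra_simps)
    hence "b * (p * m - 1) \<ge> b * (3 * k + 5)" by (intro mult_left_mono) auto
    with ineq2 have "a * (m - 1) + b * (3 * k + 5) < m * (a + b)" by linarith
    hence "a * (k + 1) + b * (3 * k + 5) < (k + 2) * (a + b)" by (simp add: k)
    hence "b * (2 * k + 3) < a" by (simp add: algebra_simps)
    moreover have "a * (k + 1) \<le> b" using ineq1 by (simp add: k algebra_simps)
    hence "a \<le> b" by (simp add: algebra_simps)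
    ultimately show False by (simp add: algebra_simps)
  qed
qed

end

section \<open>Twisted derivatives of products of linear factors\<close>

text \<open>By pigeonhole: there are more coefficient vectors than vectors of values, and the
  difference of two coefficient vectors with equal values is a solution.\<close>

lemma homogeneous_system_solution:
  fixes a :: "'z \<Rightarrow> 'q \<Rightarrow> 'a::{field,finite}"
  assumes "finite Z" and "finite Q" and "card Q < card Z"
  obtains b where "\<exists>z\<in>Z. b z \<noteq> 0" and "\<And>q. q \<in> Q \<Longrightarrow> (\<Sum>z\<in>Z. b z * a z q) = 0"
proof -
  define L where "L b = (\<lambda>q\<in>Q. \<Sum>z\<in>Z. b z * a z q)" for b
  define X where "X = (Z \<rightarrow>\<^sub>E (UNIV :: 'a set))"
  have "L ` X \<subseteq> Q \<rightarrow>\<^sub>E UNIV" by (auto simp: L_def)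
  hence "card (L ` X) \<le> card (Q \<rightarrow>\<^sub>E (UNIV :: 'a set))"
    by (rule card_mono[rotated]) (simp add: finite_PiE assms(2))
  also have "\<dots> = CARD('a) ^ card Q" by (simp add: card_PiE assms(2))
  also have "\<dots> < CARD('a) ^ card Z"
    using assms(3) two_le_card_field[where 'a = 'a] by (intro power_strict_increasing) auto
  also have "\<dots> = card X" by (simp add: X_def card_PiE assms(1))
  finally have "\<not> inj_on L X" by (metis card_image less_irrefl)
  then obtain b1 b2 where b: "b1 \<in> X" "b2 \<in> X" "L b1 = L b2" "b1 \<noteq> b2" by (auto simp: inj_on_def)
  show ?thesis
  proof (rule that[of "\<lambda>z. b1 z - b2 z"])
    show "\<exists>z\<in>Z. b1 z - b2 z \<noteq> 0"
      using b PiE_ext[of b1 Z "\<lambda>_. UNIV" b2] by (auto simp: X_def)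
    show "(\<Sum>z\<in>Z. (b1 z - b2 z) * a z q) = 0" if "q \<in> Q" for q
      using fun_cong[OF b(3), of q] that by (simp add: L_def left_diff_distrib sum_subtractf)
  qed
qed


lemma sum_order_le:
  fixes P :: "'a::idom poly"
  assumes "P \<noteq> 0" and "finite A"
  shows "(\<Sum>x\<in>A. Polynomial.order x P) \<le> degree P"
proof -
  have "(\<Sum>x\<in>A. Polynomial.order x P) = (\<Sum>x\<in>A \<inter> {x. poly P x = 0}. Polynomial.order x P)"
    by (rule sum.mono_neutral_right) (use assms in \<open>auto simp: order_root\<close>)
  also have "\<dots> \<le> (\<Sum>x | poly P x = 0. Polynomial.order x P)"
    by (rule sum_mono2) (use assms in \<open>auto simp: poly_roots_finite\<close>)
  also have "\<dots> \<le> degree P" by (rule sum_order_le_degree[OF assms(1)])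
  finally show ?thesis .
qed

lemma sum_digits: "(\<Sum>i<n. (a div p ^ i mod p) * p ^ i) = (a::nat) mod p ^ n"
proof (induction n)
  case (Suc n)
  have "a mod (p ^ n * p) = p ^ n * (a div p ^ n mod p) + a mod p ^ n" by (rule mod_mult2_eq)
  thus ?case using Suc by (simp add: mult.commute)
qed simp

lemma sum_top_digits:
  assumes "p > 0"
  shows "(\<Sum>i<n. (p - 1) * p ^ i) = p ^ n - (1::nat)"
proof (induction n)
  case (Suc n)
  have "p ^ n \<le> p * p ^ n" "1 \<le> p ^ n" using assms by auto
  thus ?case using Suc by (simp add: diff_mult_distrib)
qed simp

section \<open>Logarithmic derivatives and twisted derivatives\<close>

definition linear_product :: "('i \<Rightarrow> 'a) \<Rightarrow> ('i \<Rightarrow> nat) \<Rightarrow> 'i set \<Rightarrow> 'a::field poly" where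
  "linear_product c e I = (\<Prod>i\<in>I. [:c i, 1:] ^ e i)"

text \<open>Numerator of the logarithmic derivative, the sum of the \<open>e i / (X + c i)\<close>,
  over the common denominator.\<close>

definition log_deriv_numerator :: "('i \<Rightarrow> 'a) \<Rightarrow> ('i \<Rightarrow> nat) \<Rightarrow> 'i set \<Rightarrow> 'a::field poly" where
  "log_deriv_numerator c e I = (\<Sum>i\<in>I. smult (of_nat (e i)) (\<Prod>j\<in>I - {i}. [:c j, 1:]))"

lemma log_deriv_linear_product:
  assumes "finite I"
  shows "(\<Prod>i\<in>I. [:c i, 1:]) * pderiv (linear_product c e I) =
    log_deriv_numerator c e I * linear_product c e I"
  using assms
proof (induction I rule: finite_induct)
  case empty
  show ?case by (simp add: log_deriv_numerator_def linear_product_def)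
next
  case (insert a I)
  define l S P Q where "l = [:c a, 1:]" and "S = (\<Prod>i\<in>I. [:c i, 1:])"
    and "P = linear_product c e I" and "Q = log_deriv_numerator c e I"
  have dl: "l * pderiv (l ^ e a) = smult (of_nat (e a)) (l ^ e a)"
  proof (cases "e a")
    case (Suc k)
    have "pderiv l = 1" by (simp add: l_def pderiv_pCons)
    thus ?thesis unfolding Suc pderiv_power_Suc by simp
  qed simp
  have "log_deriv_numerator c e (insert a I) = smult (of_nat (e a)) S + l * Q"
  proof -
    have "(\<Prod>j\<in>insert a I - {i}. [:c j, 1:]) = l * (\<Prod>j\<in>I - {i}. [:c j, 1:])" if "i \<in> I" for i
    proof -
      have "insert a I - {i} = insert a (I - {i})" using insert.hyps that by auto
      thus ?thesis using insert.hyps by (simp add: l_def del: mult_pCons_left)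
    qed
    moreover have "insert a I - {a} = I" using insert.hyps by auto
    ultimately show ?thesis using insert.hyps
      by (simp add: log_deriv_numerator_def Q_def S_def sum_distrib_left del: mult_pCons_left)
  qed
  moreover have "linear_product c e (insert a I) = l ^ e a * P"
    using insert.hyps by (simp add: linear_product_def l_def P_def)
  moreover have "(\<Prod>i\<in>insert a I. [:c i, 1:]) = l * S"
    using insert.hyps by (simp add: l_def S_def del: mult_pCons_left)
  moreover have "l * S * pderiv (l ^ e a * P) = l * l ^ e a * (S * pderiv P) + (l * pderiv (l ^ e a)) * S * P"
    by (simp add: pderiv_mult algebra_simps)
  ultimately show ?case using insert.IH unfolding dl
    by (simp add: P_def[symmetric] Q_def[symmetric] S_def[symmetric] algebra_simps)
qed

lemma degree_log_deriv_numerator: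
  assumes "finite I"
  shows "degree (log_deriv_numerator c e I) \<le> card I - 1"
  unfolding log_deriv_numerator_def
proof (rule degree_sum_le)
  fix i assume "i \<in> I"
  have "degree (smult (of_nat (e i)) (\<Prod>j\<in>I - {i}. [:c j, 1:])) \<le> card (I - {i})"
    by (rule order_trans[OF degree_smult_le]) (use assms in \<open>simp add: degree_prod_linear\<close>)
  thus "degree (smult (of_nat (e i)) (\<Prod>j\<in>I - {i}. [:c j, 1:])) \<le> card I - 1"
    using \<open>i \<in> I\<close> assms by (simp add: card_Diff_singleton)
qed (fact assms)

lemma coeff_log_deriv_numerator:
  assumes "finite I"
  shows "poly.coeff (log_deriv_numerator c e I) (card I - 1) = of_nat (\<Sum>i\<in>I. e i)"
proof -
  have "poly.coeff (\<Prod>j\<in>I - {i}. [:c j, 1:]) (card I - 1) = 1" if "i \<in> I" for i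
  proof -
    have "card I - 1 = degree (\<Prod>j\<in>I - {i}. [:c j, 1:])"
      using assms that by (simp add: degree_prod_linear card_Diff_singleton)
    thus ?thesis using lead_coeff_prod_linear[of c "I - {i}"] by simp
  qed
  thus ?thesis by (simp add: log_deriv_numerator_def coeff_sum)
qed

text \<open>\<open>S\<close> serves as common denominator of the logarithmic derivatives, of degree
  \<open>h + 1\<close>; the parameter \<open>\<kappa>\<close> is left free to cancel a leading
  coefficient.\<close>

definition twisted_deriv :: "'a poly \<Rightarrow> nat \<Rightarrow> 'a \<Rightarrow> 'a::field poly \<Rightarrow> 'a poly" where
  "twisted_deriv S h \<kappa> P = S * pderiv P - smult \<kappa> (monom 1 h * P)"

lemma twisted_deriv_0 [simp]: "twisted_deriv S h \<kappa> 0 = 0"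
  by (simp add: twisted_deriv_def)

lemma twisted_deriv_add:
  "twisted_deriv S h \<kappa> (P + Q) = twisted_deriv S h \<kappa> P + twisted_deriv S h \<kappa> Q"
  by (simp add: twisted_deriv_def pderiv_add algebra_simps smult_add_right)

lemma twisted_deriv_smult:
  "twisted_deriv S h \<kappa> (smult b P) = smult b (twisted_deriv S h \<kappa> P)"
  by (simp add: twisted_deriv_def pderiv_smult smult_diff_right mult.commute)

fun iter_twisted :: "'a poly \<Rightarrow> nat \<Rightarrow> (nat \<Rightarrow> 'a) \<Rightarrow> nat \<Rightarrow> 'a::field poly \<Rightarrow> 'a poly" where
  "iter_twisted S h \<kappa> 0 P = P"
| "iter_twisted S h \<kappa> (Suc l) P = twisted_deriv S h (\<kappa> l) (iter_twisted S h \<kappa> l P)"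

lemma iter_twisted_sum:
  assumes "finite Z"
  shows "iter_twisted S h \<kappa> l (\<Sum>z\<in>Z. smult (b z) (P z)) =
    (\<Sum>z\<in>Z. smult (b z) (iter_twisted S h \<kappa> l (P z)))"
proof (induction l)
  case (Suc l)
  have "twisted_deriv S h (\<kappa> l) (\<Sum>z\<in>Z. smult (b z) (R z)) =
      (\<Sum>z\<in>Z. smult (b z) (twisted_deriv S h (\<kappa> l) (R z)))" for R
    using assms by (induction Z rule: finite_induct) (simp_all add: twisted_deriv_add twisted_deriv_smult)
  thus ?case using Suc by simp
qed simp

text \<open>If \<open>\<Lambda> / S\<close> is the logarithmic derivative of \<open>\<chi>\<close>,
  the iterated twisted derivatives of \<open>A \<chi>\<close> remain multiples of
  \<open>\<chi>\<close>; these are the cofactors.\<close>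

fun iter_coeff :: "'a poly \<Rightarrow> nat \<Rightarrow> (nat \<Rightarrow> 'a) \<Rightarrow> 'a poly \<Rightarrow> nat \<Rightarrow> 'a::field poly \<Rightarrow> 'a poly" where
  "iter_coeff S h \<kappa> \<Lambda> 0 A = A"
| "iter_coeff S h \<kappa> \<Lambda> (Suc l) A =
    twisted_deriv S h (\<kappa> l) (iter_coeff S h \<kappa> \<Lambda> l A) + \<Lambda> * iter_coeff S h \<kappa> \<Lambda> l A"

lemma iter_twisted_mult:
  assumes "S * pderiv \<chi> = \<Lambda> * \<chi>"
  shows "iter_twisted S h \<kappa> l (A * \<chi>) = iter_coeff S h \<kappa> \<Lambda> l A * \<chi>"
proof (induction l)
  case (Suc l)
  have "twisted_deriv S h (\<kappa> l) (B * \<chi>) = (twisted_deriv S h (\<kappa> l) B + \<Lambda> * B) * \<chi>" for B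
  proof -
    have "S * pderiv (B * \<chi>) = B * (S * pderiv \<chi>) + S * pderiv B * \<chi>"
      by (simp add: pderiv_mult algebra_simps)
    thus ?thesis unfolding assms by (simp add: twisted_deriv_def algebra_simps)
  qed
  thus ?case using Suc by simp
qed simp

text \<open>
  The twist \<open>\<kappa>\<close> cancels the leading coefficient, so that one step raises the degree of the
  cofactor of \<open>\<chi>\<close> by \<open>h - 1\<close> only.
\<close>

lemma degree_iter_coeff:
  assumes "h \<ge> 1" and "degree S \<le> Suc h" and "poly.coeff S (Suc h) = 1"
    and "degree \<Lambda> \<le> h" and "\<And>l. \<kappa> l = of_nat (\<delta> + (h - 1) * l) + poly.coeff \<Lambda> h"
    and "degree A \<le> \<delta>"
  shows "degree (iter_coeff S h \<kappa> \<Lambda> l A) \<le> \<delta> + (h - 1) * l"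
proof (induction l)
  case (Suc l)
  define B D where "B = iter_coeff S h \<kappa> \<Lambda> l A" and "D = \<delta> + (h - 1) * l"
  have B: "degree B \<le> D" using Suc by (simp add: B_def D_def)
  have dB: "degree (pderiv B) \<le> D - 1" using degree_pderiv_le[of B] B by linarith
  define E where "E = twisted_deriv S h (\<kappa> l) B + \<Lambda> * B"
  have X: "degree (monom (1::'a) h) \<le> h" by (simp add: degree_monom_eq)
  have degS: "degree (S * pderiv B) \<le> D + h"
  proof (cases "D = 0")
    case True
    hence "pderiv B = 0" using B by (metis degree_eq_zeroE le_zero_eq pderiv_singleton)
    thus ?thesis by simp
  next
    case False
    thus ?thesis using degree_mult_le[of S "pderiv B"] assms(2) dB by linarith
  qed
  have degX: "degree (smult (\<kappa> l) (monom 1 h * B)) \<le> D + h"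
    using degree_smult_le[of "\<kappa> l" "monom 1 h * B"] degree_mult_le[of "monom 1 h" B] X B by linarith
  have degL: "degree (\<Lambda> * B) \<le> D + h" using degree_mult_le[of \<Lambda> B] assms(4) B by linarith
  have E: "degree E \<le> D + h"
    unfolding E_def twisted_deriv_def
    by (intro degree_add_le degree_diff_le degS degX degL)
  have cS: "poly.coeff (S * pderiv B) (D + h) = of_nat D * poly.coeff B D"
  proof (cases "D = 0")
    case True
    hence "pderiv B = 0" using B by (metis degree_eq_zeroE le_zero_eq pderiv_singleton)
    thus ?thesis using True by simp
  next
    case False
    hence "D + h = Suc h + (D - 1)" by simp
    thus ?thesis using coeff_mult_top[OF assms(2) dB] False assms(3)
      by (simp add: coeff_pderiv add.commute)
  qed
  have "\<kappa> l = of_nat D + poly.coeff \<Lambda> h" by (simp add: assms(5) D_def)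
  hence "poly.coeff E (h + D) = 0"
    using coeff_mult_top[OF X B] coeff_mult_top[OF assms(4) B] cS
    by (simp add: E_def twisted_deriv_def add.commute algebra_simps)
  hence "degree E \<le> D + h - 1"
  proof (intro degree_le allI impI)
    fix i assume i: "D + h - 1 < i"
    show "poly.coeff E i = 0"
    proof (cases "i = h + D")
      case True
      thus ?thesis using \<open>poly.coeff E (h + D) = 0\<close> by simp
    next
      case False
      thus ?thesis using i E by (intro coeff_eq_0) linarith
    qed
  qed
  moreover have "D + h - 1 = \<delta> + (h - 1) * Suc l" using assms(1) by (simp add: D_def)
  ultimately show ?case by (simp add: E_def B_def)
qed (use assms(6) in simp)

section \<open>Orders of vanishing from iterated derivatives\<close>

context prime_power_field
begin

text \<open>Induction on the order \<open>u\<close>, for all iterates at once. If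
  \<open>\<Phi>\<close> and its twisted derivative are divisible by \<open>(X - t) ^ u\<close> with
  \<open>0 < u < p\<close>, so is \<open>S\<close> times the derivative of \<open>\<Phi>\<close>. As
  \<open>S(t)\<close> and \<open>u\<close> are nonzero in the field, the order of
  \<open>\<Phi>\<close> exceeds \<open>u\<close>.\<close>

lemma iter_twisted_vanishing:
  fixes P :: "'a poly"
  assumes "M \<le> p" and "poly S t \<noteq> 0"
    and "\<And>l. l < M \<Longrightarrow> poly (iter_twisted S h \<kappa> l P) t = 0"
  shows "[:- t, 1:] ^ M dvd P"
proof -
  have "[:- t, 1:] ^ u dvd iter_twisted S h \<kappa> l P" if "l + u \<le> M" for u l
    using that
  proof (induction u arbitrary: l)
    case (Suc u)
    define \<Phi> where "\<Phi> = iter_twisted S h \<kappa> l P"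
    have "[:- t, 1:] ^ u dvd \<Phi>" unfolding \<Phi>_def by (rule Suc.IH) (use Suc.prems in simp)
    then obtain \<rho> where \<rho>: "\<Phi> = [:- t, 1:] ^ u * \<rho>" by (elim dvdE)
    have "poly \<rho> t = 0"
    proof (cases u)
      case 0
      thus ?thesis using \<rho> assms(3)[of l] Suc.prems by (simp add: \<Phi>_def)
    next
      case (Suc v)
      have "[:- t, 1:] ^ u dvd twisted_deriv S h (\<kappa> l) \<Phi>"
        using Suc.IH[of "Suc l"] Suc.prems by (simp add: \<Phi>_def)
      moreover have "[:- t, 1:] ^ u dvd smult (\<kappa> l) (monom 1 h * \<Phi>)"
        unfolding \<rho> by (intro dvd_smult dvd_mult dvd_triv_left)
      ultimately have "[:- t, 1:] ^ u dvd
          twisted_deriv S h (\<kappa> l) \<Phi> + smult (\<kappa> l) (monom 1 h * \<Phi>)" by (rule dvd_add)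
      hence "[:- t, 1:] ^ u dvd S * pderiv \<Phi>" by (simp add: twisted_deriv_def)
      moreover have "pderiv \<Phi> = [:- t, 1:] ^ u * pderiv \<rho> + smult (of_nat u) ([:- t, 1:] ^ v * \<rho>)"
        unfolding \<rho> Suc pderiv_mult pderiv_power_Suc by (simp add: pderiv_pCons mult.commute)
      ultimately have "[:- t, 1:] ^ u dvd
          [:- t, 1:] ^ u * (S * pderiv \<rho>) + S * smult (of_nat u) ([:- t, 1:] ^ v * \<rho>)"
        by (simp add: algebra_simps del: mult_pCons_left mult_pCons_right)
      hence "[:- t, 1:] ^ u dvd S * smult (of_nat u) ([:- t, 1:] ^ v * \<rho>)"
        by (metis dvd_add_right_iff dvd_triv_left)
      hence "[:- t, 1:] ^ v * [:- t, 1:] dvd [:- t, 1:] ^ v * (S * smult (of_nat u) \<rho>)"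
        by (simp add: Suc mult_ac del: mult_pCons_left mult_pCons_right)
      hence "[:- t, 1:] dvd S * smult (of_nat u) \<rho>"
        by (subst (asm) dvd_mult_cancel_left) auto
      hence "poly (S * smult (of_nat u) \<rho>) t = 0" by (simp only: poly_eq_0_iff_dvd)
      moreover have "of_nat u \<noteq> (0::'a)"
      proof -
        have "0 < u" "u < p" using Suc Suc.prems assms(1) by auto
        thus ?thesis by (auto simp: of_nat_eq_0_iff dest: dvd_imp_le)
      qed
      ultimately show ?thesis using assms(2) by simp
    qed
    then obtain \<tau> where "\<rho> = [:- t, 1:] * \<tau>" by (auto simp: poly_eq_0_iff_dvd elim: dvdE)
    hence "\<Phi> = [:- t, 1:] ^ Suc u * \<tau>" using \<rho> by (simp only: power_Suc mult_ac)
    thus ?case by (simp only: \<Phi>_def dvd_triv_left)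
  qed simp
  from this[of 0 M] show ?thesis by simp
qed

lemma of_nat_frob: "(of_nat i :: 'a) ^ p = of_nat i"
proof (induction i)
  case (Suc i)
  have "(of_nat (Suc i) :: 'a) ^ p = (of_nat i + 1) ^ (p ^ 1)" by (simp add: add.commute)
  also have "\<dots> = of_nat (Suc i)" unfolding frob_add using Suc by simp
  finally show ?case .
qed (use prime_p in \<open>simp add: prime_gt_0_nat\<close>)

lemma of_nat_frob_power: "(of_nat i :: 'a) ^ (p ^ j) = of_nat i"
  by (induction j) (simp_all add: power_mult of_nat_frob mult.commute)

lemma inj_on_of_nat: "inj_on (of_nat :: nat \<Rightarrow> 'a) {..<p}"
proof (rule linorder_inj_onI)
  fix i j :: nat assume ij: "i < j" "i \<in> {..<p}" "j \<in> {..<p}"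
  show "of_nat i \<noteq> (of_nat j :: 'a)"
  proof
    assume "of_nat i = (of_nat j :: 'a)"
    hence "of_nat (j - i) = (0::'a)" using ij by (simp add: of_nat_diff)
    hence "p dvd j - i" by (simp add: of_nat_eq_0_iff)
    thus False using ij by (auto dest: dvd_imp_le)
  qed
qed auto

end

section \<open>Stepanov's method on sublines\<close>

text \<open>To be used with \<open>\<alpha> = F x\<close>, \<open>\<beta> = x\<close> and
  \<open>k\<close> the order of \<open>H\<close>. The inequalities separate the conjugates of
  \<open>\<alpha>\<close> from each other and from those of \<open>\<beta>\<close>, and keep
  \<open>t + \<beta>\<close> nonzero for \<open>t\<close> in the prime field.\<close>

locale power_character = prime_power_field field_type p n
  for field_type :: "'a::{field,finite} itself" and p n :: nat +
  fixes \<alpha> \<beta> :: 'a and k d :: nat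
  assumes two_le_n: "2 \<le> n" and dk: "d * k = p ^ n - 1" and two_le_d: "2 \<le> d"
    and \<alpha>_generates: "\<And>i. 1 \<le> i \<Longrightarrow> i < n \<Longrightarrow> \<alpha> ^ (p ^ i) \<noteq> \<alpha>"
    and not_conjugate: "\<And>i. i < n \<Longrightarrow> \<beta> ^ (p ^ i) \<noteq> \<alpha>"
    and \<beta>_not_prime_field: "\<beta> ^ p \<noteq> \<beta>"
begin

definition conj_root :: "nat \<Rightarrow> 'a" where
  "conj_root i = (if i < n then \<alpha> ^ (p ^ i) else \<beta> ^ (p ^ (i - n)))"

definition digit :: "nat \<Rightarrow> nat \<Rightarrow> nat" where
  "digit j i = j * k div p ^ i mod p"

text \<open>Since \<open>(t + \<beta>) ^ (q - 1) = 1\<close>, the complementary digits, those of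
  \<open>q - 1 - j k\<close>, express division by \<open>(t + \<beta>) ^ (j k)\<close>.\<close>

definition expo :: "nat \<Rightarrow> nat \<Rightarrow> nat" where
  "expo j i = (if i < n then digit j i else p - 1 - digit j (i - n))"

text \<open>
  On the prime field, the polynomial \<open>char_poly j\<close> of degree only \<open>n (p - 1)\<close> agrees with
  \<open>((t + \<alpha>) / (t + \<beta>)) ^ (j * k)\<close>: there, \<open>(t + \<alpha>) ^ (p ^ i) = t + \<alpha> ^ (p ^ i)\<close>.
\<close>

definition char_poly :: "nat \<Rightarrow> 'a poly" where
  "char_poly j = linear_product conj_root (expo j) {..<2 * n}"

text \<open>The \<open>p\<close>-th root of \<open>\<alpha>\<close>; its exponent in
  \<open>char_poly j\<close> is the leading digit of \<open>j k\<close>.\<close>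

definition base_root :: 'a where
  "base_root = \<alpha> ^ (p ^ (n - 1))"

definition top_digit :: "nat \<Rightarrow> nat" where
  "top_digit j = j * k div p ^ (n - 1)"

lemma card_split: "p ^ (n - 1) * p = p ^ n"
  using two_le_n by (intro power_minus_mult) simp

lemma sum_split_2n: "(\<Sum>i<2 * n. g i) = (\<Sum>i<n. g i) + (\<Sum>i<n. g (n + i))"
  for g :: "nat \<Rightarrow> nat"
proof -
  have "(\<Sum>i<2 * n. g i) = (\<Sum>i<n. g i) + (\<Sum>i\<in>{n..<2 * n}. g i)"
    unfolding lessThan_atLeast0 by (rule sum.atLeastLessThan_concat[symmetric]) simp_all
  also have "(\<Sum>i\<in>{n..<2 * n}. g i) = (\<Sum>i<n. g (n + i))"
    by (rule sum.reindex_bij_witness[of _ "\<lambda>i. n + i" "\<lambda>i. i - n"]) auto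
  finally show ?thesis .
qed

lemma prod_split_2n: "(\<Prod>i<2 * n. g i) = (\<Prod>i<n. g i) * (\<Prod>i<n. g (n + i))"
  for g :: "nat \<Rightarrow> 'b::comm_monoid_mult"
proof -
  have "(\<Prod>i<2 * n. g i) = (\<Prod>i<n. g i) * (\<Prod>i\<in>{n..<2 * n}. g i)"
    unfolding lessThan_atLeast0 by (rule prod.atLeastLessThan_concat[symmetric]) simp_all
  also have "(\<Prod>i\<in>{n..<2 * n}. g i) = (\<Prod>i<n. g (n + i))"
    by (rule prod.reindex_bij_witness[of _ "\<lambda>i. n + i" "\<lambda>i. i - n"]) auto
  finally show ?thesis .
qed

lemma digit_le: "digit j i \<le> p - 1"
proof -
  have "digit j i < p" using p_pos by (simp add: digit_def)
  thus ?thesis by simp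
qed

lemma digit_add: "digit j i + (p - 1 - digit j i) = p - 1"
  using digit_le[of j i] by linarith

text \<open>Each digit and its complement add up to \<open>p - 1\<close>. As the sum does not depend
  on \<open>j\<close>, one twist \<open>\<kappa>\<close> will suit all basis polynomials.\<close>

lemma sum_expo: "(\<Sum>i<2 * n. expo j i) = n * (p - 1)"
proof -
  have "(\<Sum>i<2 * n. expo j i) = (\<Sum>i<n. digit j i + (p - 1 - digit j i))"
    unfolding sum_split_2n sum.distrib by (simp add: expo_def)
  also have "\<dots> = (\<Sum>i<n. p - 1)" by (simp only: digit_add)
  finally show ?thesis by simp
qed

lemma degree_char_poly: "degree (char_poly j) = n * (p - 1)"
proof -
  have "degree (char_poly j) = (\<Sum>i<2 * n. degree ([:conj_root i, 1:] ^ expo j i))"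
    unfolding char_poly_def linear_product_def by (rule degree_prod_eq_sum_degree) auto
  also have "\<dots> = (\<Sum>i<2 * n. expo j i)" by (simp add: degree_power_eq)
  finally show ?thesis by (simp only: sum_expo)
qed

lemma jk_less:
  assumes "j \<le> d"
  shows "j * k < p ^ n"
proof -
  have "j * k \<le> d * k" using assms by (rule mult_le_mono1)
  moreover have "0 < p ^ n" using p_pos by simp
  ultimately show ?thesis using dk by linarith
qed

section \<open>Evaluation on the prime field\<close>

lemma prime_field_plus_nonzero:
  fixes x :: 'a
  assumes "x ^ p \<noteq> x"
  shows "of_nat t + x \<noteq> 0"
proof
  assume 0: "of_nat t + x = 0"
  have "(of_nat t + x) ^ (p ^ 1) = of_nat t + x ^ (p ^ 1)"
    by (simp only: frob_add of_nat_frob_power)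
  hence "of_nat t + x ^ p = of_nat t + x" using 0 zero_power[OF p_pos, where 'a = 'a] by simp
  thus False using assms by simp
qed

lemma prime_field_plus_\<alpha>: "of_nat t + \<alpha> \<noteq> 0"
  using \<alpha>_generates[of 1] two_le_n by (intro prime_field_plus_nonzero) simp

lemma prime_field_plus_\<beta>: "of_nat t + \<beta> \<noteq> 0"
  using \<beta>_not_prime_field by (rule prime_field_plus_nonzero)

lemma prime_field_plus_conj_root:
  "of_nat t + conj_root i = (if i < n then (of_nat t + \<alpha>) ^ (p ^ i) else (of_nat t + \<beta>) ^ (p ^ (i - n)))"
  by (simp add: conj_root_def frob_add of_nat_frob_power)

lemma poly_char_poly:
  assumes "j \<le> d"
  shows "poly (char_poly j) (of_nat t) = (((of_nat t + \<alpha>) / (of_nat t + \<beta>)) ^ k) ^ j"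
proof -
  let ?a = "of_nat t + \<alpha>" and ?b = "of_nat t + \<beta>"
  have digits: "(\<Sum>i<n. digit j i * p ^ i) = j * k"
    unfolding digit_def sum_digits using jk_less[OF assms] by simp
  have "(\<Sum>i<n. p ^ i * (p - 1 - digit j i)) + j * k =
      (\<Sum>i<n. p ^ i * (p - 1 - digit j i) + digit j i * p ^ i)"
    by (simp only: sum.distrib digits)
  also have "\<dots> = (\<Sum>i<n. (p - 1) * p ^ i)"
  proof (rule sum.cong)
    fix i
    have "p ^ i * (p - 1 - digit j i) + digit j i * p ^ i = p ^ i * ((p - 1 - digit j i) + digit j i)"
      by (simp add: algebra_simps)
    thus "p ^ i * (p - 1 - digit j i) + digit j i * p ^ i = (p - 1) * p ^ i"
      using digit_add[of j i] by (simp add: mult.commute add.commute)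
  qed simp
  also have "\<dots> = p ^ n - 1" by (rule sum_top_digits[OF p_pos])
  finally have co: "(\<Sum>i<n. p ^ i * (p - 1 - digit j i)) + j * k = p ^ n - 1" .
  have "poly (char_poly j) (of_nat t) = (\<Prod>i<2 * n. (of_nat t + conj_root i) ^ expo j i)"
    by (simp add: char_poly_def linear_product_def poly_prod add.commute)
  also have "\<dots> = (\<Prod>i<n. ?a ^ (p ^ i * digit j i)) * (\<Prod>i<n. ?b ^ (p ^ i * (p - 1 - digit j i)))"
    unfolding prod_split_2n prime_field_plus_conj_root by (simp add: expo_def flip: power_mult)
  also have "\<dots> = ?a ^ (j * k) * ?b ^ (\<Sum>i<n. p ^ i * (p - 1 - digit j i))"
  proof -
    have "(\<Sum>i<n. p ^ i * digit j i) = j * k" using digits by (simp add: mult.commute)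
    thus ?thesis by (simp flip: power_sum)
  qed
  also have "\<dots> = ?a ^ (j * k) / ?b ^ (j * k)"
  proof -
    have "?b ^ (\<Sum>i<n. p ^ i * (p - 1 - digit j i)) * ?b ^ (j * k) = 1"
      unfolding power_add[symmetric] co by (rule pow_card_minus_1[OF prime_field_plus_\<beta>])
    thus ?thesis using prime_field_plus_\<beta>[of t] by (simp add: field_simps)
  qed
  finally show ?thesis by (simp add: power_divide mult.commute flip: power_mult)
qed

lemma base_root_frob: "base_root ^ p = \<alpha>"
proof -
  have "base_root ^ p = \<alpha> ^ (p ^ (n - 1) * p)" by (simp add: base_root_def power_mult)
  also have "p ^ (n - 1) * p = p ^ n" by (rule card_split)
  finally show ?thesis by (simp add: pow_card)
qed

text \<open>The \<open>p\<close>-th power of a coincidence would make \<open>\<alpha>\<close> a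
  fixed point of a smaller power of Frobenius or a conjugate of \<open>\<beta>\<close>.\<close>

lemma conj_root_neq_base:
  assumes "i < 2 * n" and "i \<noteq> n - 1"
  shows "conj_root i \<noteq> base_root"
proof
  assume eq: "conj_root i = base_root"
  show False
  proof (cases "i < n")
    case True
    hence i: "Suc i < n" using assms(2) by linarith
    have "\<alpha> ^ (p ^ Suc i) = (conj_root i) ^ p" using True by (simp add: conj_root_def mult.commute flip: power_mult)
    also have "\<dots> = \<alpha>" by (simp add: eq base_root_frob)
    finally show False using \<alpha>_generates[of "Suc i"] i by simp
  next
    case False
    define l where "l = i - n"
    have l: "l < n" using assms(1) False by (simp add: l_def)
    have "\<beta> ^ (p ^ Suc l) = (conj_root i) ^ p"
      using False by (simp add: conj_root_def mult.commute l_def flip: power_mult)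
    also have "\<dots> = \<alpha>" by (simp add: eq base_root_frob)
    finally have conj: "\<beta> ^ (p ^ Suc l) = \<alpha>" .
    show False
    proof (cases "Suc l = n")
      case True
      hence "\<beta> = \<alpha>" using conj by (simp add: pow_card del: power_Suc)
      thus False using not_conjugate[of 0] two_le_n by simp
    next
      case False
      thus False using conj not_conjugate[of "Suc l"] l by simp
    qed
  qed
qed

lemma digit_top: "j \<le> d \<Longrightarrow> digit j (n - 1) = top_digit j"
proof -
  assume "j \<le> d"
  hence "j * k < p ^ (n - 1) * p" using jk_less card_split by simp
  hence "j * k div p ^ (n - 1) < p" by (simp add: less_mult_imp_div_less mult.commute)
  thus ?thesis by (simp add: digit_def top_digit_def)
qed

lemma char_poly_decomp:
  assumes "j \<le> d"
  obtains \<omega> where "char_poly j = [:base_root, 1:] ^ top_digit j * \<omega>" and "poly \<omega> (- base_root) \<noteq> 0"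
proof
  let ?\<omega> = "\<Prod>i\<in>{..<2 * n} - {n - 1}. [:conj_root i, 1:] ^ expo j i"
  have n1: "n - 1 \<in> {..<2 * n}" using two_le_n by simp
  have "char_poly j = [:conj_root (n - 1), 1:] ^ expo j (n - 1) * ?\<omega>"
    unfolding char_poly_def linear_product_def by (rule prod.remove) (use n1 in auto)
  moreover have "conj_root (n - 1) = base_root" "expo j (n - 1) = top_digit j"
    using two_le_n digit_top[OF assms] by (auto simp: conj_root_def base_root_def expo_def)
  ultimately show "char_poly j = [:base_root, 1:] ^ top_digit j * ?\<omega>" by simp
  have "poly ?\<omega> (- base_root) = (\<Prod>i\<in>{..<2 * n} - {n - 1}. (conj_root i - base_root) ^ expo j i)"
    by (simp add: poly_prod)
  also have "\<dots> \<noteq> 0" using conj_root_neq_base by (auto simp: prod_zero_iff)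
  finally show "poly ?\<omega> (- base_root) \<noteq> 0" .
qed

text \<open>
  The top digits of \<open>k, 2 k, \<dots>, d k\<close> cut the residues modulo \<open>p\<close> into consecutive intervals.
  The \<open>z\<close>-th basis polynomial uses the \<open>j\<close> whose interval contains \<open>top_digit 1 + z mod p\<close>, so that
  it vanishes at \<open>- base_root\<close> to the order \<open>top_digit 1 + z\<close> exactly.
\<close>

definition slot :: "nat \<Rightarrow> nat" where
  "slot z = Max {j\<in>{1..d}. top_digit j \<le> top_digit 1 + z mod p}"

definition offset :: "nat \<Rightarrow> nat" where
  "offset z = top_digit 1 + z mod p - top_digit (slot z)"

text \<open>The first factor raises the order from the leading digit to the target. The
  \<open>p\<close>-th power has derivative zero and takes the value \<open>t + \<alpha>\<close> at
  \<open>t\<close> in the prime field, so there it can be replaced by a polynomial of degree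
  1.\<close>

definition basis_poly :: "nat \<Rightarrow> 'a poly" where
  "basis_poly z = [:base_root, 1:] ^ offset z * ([:base_root, 1:] ^ p) ^ (z div p) * char_poly (slot z)"

lemma slot_mem: "slot z \<in> {1..d}" and top_digit_slot: "top_digit (slot z) \<le> top_digit 1 + z mod p"
proof -
  let ?J = "{j\<in>{1..d}. top_digit j \<le> top_digit 1 + z mod p}"
  have "1 \<in> ?J" using two_le_d by simp
  hence "slot z \<in> ?J" unfolding slot_def by (intro Max_in) auto
  thus "slot z \<in> {1..d}" "top_digit (slot z) \<le> top_digit 1 + z mod p" by auto
qed

text \<open>All base \<open>p\<close> digits of \<open>d k = q - 1\<close> are
  \<open>p - 1\<close>.\<close>

lemma top_digit_d: "top_digit d = p - 1"
proof -
  have "p ^ n - 1 = p ^ (n - 1) * (p - 1) + (p ^ (n - 1) - 1)"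
  proof -
    note card_split[symmetric]
    moreover have "p ^ (n - 1) * p \<ge> p ^ (n - 1)" "p ^ (n - 1) \<ge> 1" using p_pos by auto
    ultimately show ?thesis by (simp add: diff_mult_distrib2)
  qed
  moreover have "(p ^ (n - 1) * (p - 1) + (p ^ (n - 1) - 1)) div p ^ (n - 1) = p - 1"
    using p_pos by (subst div_mult_self4) (auto simp: div_less)
  ultimately show ?thesis by (simp add: top_digit_def dk)
qed

lemma top_digit_Suc: "top_digit (Suc j) \<le> top_digit j + top_digit 1 + 1"
proof -
  let ?m = "p ^ (n - 1)"
  have "(k + j * k) div ?m \<le> k div ?m + j * k div ?m + 1"
    unfolding div_add1_eq[of k "j * k"]
  proof -
    have "k mod ?m < ?m" "j * k mod ?m < ?m" using p_pos by simp_all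
    hence "k mod ?m + j * k mod ?m < 2 * ?m" by linarith
    hence "(k mod ?m + j * k mod ?m) div ?m < 2" by (rule less_mult_imp_div_less)
    thus "k div ?m + j * k div ?m + (k mod ?m + j * k mod ?m) div ?m \<le> k div ?m + j * k div ?m + 1"
      by simp
  qed
  thus ?thesis by (simp add: top_digit_def)
qed

text \<open>By maximality of the slot, the next leading digit exceeds the target, and consecutive
  leading digits differ by at most \<open>top_digit 1 + 1\<close> because a carry is at most
  1.\<close>

lemma offset_le: "offset z \<le> top_digit 1"
proof (cases "slot z = d")
  case True
  have "z mod p < p" using p_pos by simp
  thus ?thesis by (simp add: offset_def True top_digit_d)
next
  case False
  let ?J = "{j\<in>{1..d}. top_digit j \<le> top_digit 1 + z mod p}"
  have "Suc (slot z) \<notin> ?J"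
  proof
    assume "Suc (slot z) \<in> ?J"
    hence "Suc (slot z) \<le> slot z" unfolding slot_def by (intro Max_ge) auto
    thus False by simp
  qed
  hence "top_digit 1 + z mod p < top_digit (Suc (slot z))"
    using slot_mem[of z] False by auto
  thus ?thesis using top_digit_Suc[of "slot z"] by (simp add: offset_def)
qed

lemma basis_poly_decomp:
  obtains \<omega> where "basis_poly z = [:base_root, 1:] ^ (top_digit 1 + z) * \<omega>"
    and "poly \<omega> (- base_root) \<noteq> 0"
proof -
  have "slot z \<le> d" using slot_mem[of z] by simp
  then obtain \<omega> where \<omega>: "char_poly (slot z) = [:base_root, 1:] ^ top_digit (slot z) * \<omega>"
    "poly \<omega> (- base_root) \<noteq> 0" by (rule char_poly_decomp)
  have "offset z + top_digit (slot z) = top_digit 1 + z mod p"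
    using top_digit_slot[of z] by (simp add: offset_def)
  moreover have "p * (z div p) + z mod p = z" by simp
  ultimately have exponent: "top_digit 1 + z = offset z + p * (z div p) + top_digit (slot z)" by linarith
  define l where "l = [:base_root, 1:]"
  have "l ^ offset z * (l ^ p) ^ (z div p) * (l ^ top_digit (slot z) * \<omega>) = l ^ (top_digit 1 + z) * \<omega>"
    unfolding exponent power_add power_mult by (simp only: mult.assoc)
  hence "basis_poly z = [:base_root, 1:] ^ (top_digit 1 + z) * \<omega>"
    by (simp only: basis_poly_def \<omega>(1) l_def)
  thus ?thesis using \<omega>(2) that by blast
qed

lemma degree_basis_poly:
  assumes "z < p * B"
  shows "degree (basis_poly z) \<le> top_digit 1 + p * (B - 1) + n * (p - 1)"
proof -
  have "z div p < B" using assms by (simp add: less_mult_imp_div_less mult.commute)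
  hence "p * (z div p) \<le> p * (B - 1)" by (intro mult_le_mono2) simp
  moreover have "degree ([:base_root, 1:] ^ offset z) = offset z"
    "degree (([:base_root, 1:] ^ p) ^ (z div p)) = p * (z div p)"
    by (simp_all add: degree_power_eq mult.commute flip: power_mult)
  moreover have "degree (basis_poly z) \<le> degree ([:base_root, 1:] ^ offset z) +
      degree (([:base_root, 1:] ^ p) ^ (z div p)) + degree (char_poly (slot z))"
    unfolding basis_poly_def by (intro order_trans[OF degree_mult_le] add_right_mono degree_mult_le)
  ultimately show ?thesis using offset_le[of z] degree_char_poly[of "slot z"] by linarith
qed

text \<open>The orders at \<open>- base_root\<close> are pairwise distinct, so the term with the
  least \<open>z\<close> and a nonzero coefficient cannot be cancelled.\<close>

lemma basis_poly_independent:
  assumes "finite Z" and "z \<in> Z" and "b z \<noteq> 0"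
  shows "(\<Sum>z\<in>Z. smult (b z) (basis_poly z)) \<noteq> 0"
proof
  assume sum0: "(\<Sum>z\<in>Z. smult (b z) (basis_poly z)) = 0"
  let ?l = "[:base_root, 1:]"
  define z0 where "z0 = (LEAST z. z \<in> Z \<and> b z \<noteq> 0)"
  have z0: "z0 \<in> Z" "b z0 \<noteq> 0" using LeastI[of "\<lambda>z. z \<in> Z \<and> b z \<noteq> 0" z] assms by (auto simp: z0_def)
  have least: "z0 \<le> z" if "z \<in> Z" "b z \<noteq> 0" for z unfolding z0_def using that by (intro Least_le) auto
  obtain \<omega> where \<omega>: "basis_poly z0 = ?l ^ (top_digit 1 + z0) * \<omega>" "poly \<omega> (- base_root) \<noteq> 0"
    using basis_poly_decomp by blast
  have "?l ^ Suc (top_digit 1 + z0) dvd smult (b z) (basis_poly z)" if z: "z \<in> Z - {z0}" for z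
  proof (cases "b z = 0")
    case False
    hence "Suc (top_digit 1 + z0) \<le> top_digit 1 + z" using least[of z] z by auto
    hence "?l ^ Suc (top_digit 1 + z0) dvd ?l ^ (top_digit 1 + z)" by (rule le_imp_power_dvd)
    thus ?thesis using basis_poly_decomp[of z] by (metis dvd_mult2 dvd_smult)
  qed simp
  hence "?l ^ Suc (top_digit 1 + z0) dvd (\<Sum>z\<in>Z - {z0}. smult (b z) (basis_poly z))"
    by (rule dvd_sum)
  moreover have "smult (b z0) (basis_poly z0) = - (\<Sum>z\<in>Z - {z0}. smult (b z) (basis_poly z))"
    using sum0 sum.remove[OF assms(1) z0(1), of "\<lambda>z. smult (b z) (basis_poly z)"]
    by (simp add: eq_neg_iff_add_eq_0)
  ultimately have "?l ^ Suc (top_digit 1 + z0) dvd smult (b z0) (basis_poly z0)" by simp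
  hence "?l ^ (top_digit 1 + z0) * ?l dvd ?l ^ (top_digit 1 + z0) * \<omega>"
    using z0(2) by (simp add: dvd_smult_iff \<omega>(1) mult.commute del: mult_pCons_left mult_pCons_right)
  hence "?l dvd \<omega>" by (subst (asm) dvd_mult_cancel_left) auto
  hence "poly \<omega> (- base_root) = 0" by (simp add: poly_eq_0_iff_dvd)
  thus False using \<omega>(2) by simp
qed

end

text \<open>
  With \<open>P = sqrt (p / r)\<close> the bound becomes \<open>(P - M) (n M - (n - 1) P) < 0\<close>, which fails for
  \<open>M = \<lfloor>P\<rfloor>\<close>.
\<close>

lemma stepanov_numeric:
  fixes n d r p M P e :: real
  assumes P: "P\<^sup>2 * r = p" "(2 * n - 1) * d \<le> P * (d - r)" "n \<le> P"
    and M: "0 < M" "M \<le> P" "P < M + 1"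
    and pos: "2 \<le> n" "0 < d" "0 < r" and e: "e * d < p"
    and bound: "p * (M - n + 1) \<le> r * (M * e + (n - 1) * (M * (M - 1)) + M * (M - n + 1))"
  shows False
proof -
  have "d * (p * (M - n + 1)) \<le> d * (r * (M * e + (n - 1) * (M * (M - 1)) + M * (M - n + 1)))"
    using bound pos by (intro mult_left_mono) auto
  also have "\<dots> = r * M * (e * d) + r * d * M * (n * M - 2 * n + 2)"
    by algebra
  also have "\<dots> < r * M * p + r * d * M * (n * M - 2 * n + 2)"
    using e M pos by (intro add_strict_right_mono mult_strict_left_mono) auto
  also have "\<dots> \<le> r * M * p + r * d * M * (n * M)"
    using M pos by (intro add_left_mono mult_left_mono) auto
  also have "\<dots> = r * (M * p + d * n * M\<^sup>2)" by algebra
  finally have "d * (p * (M - n + 1)) < r * (M * p + d * n * M\<^sup>2)" .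
  moreover have "d * (p * (M - n + 1)) = r * (d * P\<^sup>2 * (M - n + 1))"
    unfolding P(1)[symmetric] by algebra
  moreover have "M * p = M * P\<^sup>2 * r" using P(1) by simp
  ultimately have "r * (d * P\<^sup>2 * (M - n + 1)) < r * (M * P\<^sup>2 * r + d * n * M\<^sup>2)" by simp
  hence "d * P\<^sup>2 * (M - n + 1) < M * P\<^sup>2 * r + d * n * M\<^sup>2"
    using pos by (simp only: mult_less_cancel_left_pos)
  moreover have "P * M * ((2 * n - 1) * d) \<le> P * M * (P * (d - r))"
    using P M pos by (intro mult_left_mono) auto
  moreover have "P * M * (P * (d - r)) = d * P\<^sup>2 * (M - n + 1) - M * P\<^sup>2 * r + d * P\<^sup>2 * (n - 1)"
    by algebra
  ultimately have "P * M * ((2 * n - 1) * d) < d * n * M\<^sup>2 + d * P\<^sup>2 * (n - 1)" by linarith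
  moreover have "d * ((P - M) * (n * M - (n - 1) * P)) =
      P * M * ((2 * n - 1) * d) - (d * n * M\<^sup>2 + d * P\<^sup>2 * (n - 1))" by algebra
  ultimately have "d * ((P - M) * (n * M - (n - 1) * P)) < 0" by linarith
  \<comment> \<open>From \<open>P < M + 1\<close> and \<open>n \<le> P\<close> follows
    \<open>n P \<le> n M + n \<le> n M + P\<close>.\<close>
  moreover have "0 \<le> d * ((P - M) * (n * M - (n - 1) * P))"
  proof (intro mult_nonneg_nonneg)
    have "n * P \<le> n * (M + 1)" using M pos by (intro mult_left_mono) auto
    also have "\<dots> = n * M + n" by algebra
    also have "n * P = (n - 1) * P + P" by algebra
    finally show "0 \<le> n * M - (n - 1) * P" using P(3) by linarith
  qed (use M pos in auto)
  ultimately show False by linarith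
qed

section \<open>The auxiliary polynomial\<close>

context power_character
begin

text \<open>
  Stepanov's method: unless the bound holds, linear algebra provides a nonzero combination of the
  basis polynomials, of degree less than \<open>top_digit 1 + p M\<close>, which vanishes to the order \<open>M\<close>
  at all points of the prime field and to the order \<open>top_digit 1\<close> at \<open>- base_root\<close>.
\<close>

lemma stepanov_bound:
  assumes C: "\<And>t. ((of_nat t + \<alpha>) / (of_nat t + \<beta>)) ^ k \<in> C" and nM: "n \<le> M" and Mp: "M \<le> p"
  shows "p * (M - n + 1) \<le> (\<Sum>l<M. card C * (top_digit 1 + (2 * n - 2) * l + (M - n + 1)))"
proof (rule ccontr)
  assume not_le: "\<not> ?thesis"
  \<comment> \<open>With \<open>z div p < B\<close> the degree is at most
    \<open>top_digit 1 + p (M - n) + n (p - 1)\<close>, which is less than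
    \<open>top_digit 1 + p M\<close>.\<close>
  define B where "B = M - n + 1"
  define \<delta> where "\<delta> l = top_digit 1 + (2 * n - 1 - 1) * l" for l
  \<comment> \<open>Index set of the linear conditions: iterate \<open>l\<close>, character value
    \<open>c\<close>, coefficient \<open>u\<close>.\<close>
  define Q where "Q = (SIGMA l:{..<M}. C \<times> {..<\<delta> l + B})"
  define Z where "Z = {..<p * B}"
  define S where "S = (\<Prod>i<2 * n. [:conj_root i, 1:])"
  define \<Lambda> where "\<Lambda> z = log_deriv_numerator conj_root (expo (slot z)) {..<2 * n}" for z
  define \<kappa> :: "nat \<Rightarrow> 'a" where "\<kappa> l = of_nat (\<delta> l) + of_nat (n * (p - 1))" for l
  define g where "g = [:base_root, 1:]"
  define cf where "cf l z = iter_coeff S (2 * n - 1) \<kappa> (\<Lambda> z) l (g ^ offset z)" for l z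
  \<comment> \<open>At those points of the prime field where the character takes the value
    \<open>c\<close>, this polynomial of small degree agrees with the \<open>l\<close>-th iterate of
    \<open>basis_poly z\<close>.\<close>
  define q where "q l c z = cf l z * [:\<alpha>, 1:] ^ (z div p) * [:c ^ slot z:]" for l c z
  have \<delta>_eq: "\<delta> l = top_digit 1 + (2 * n - 2) * l" for l by (simp add: \<delta>_def numeral_2_eq_2)
  have "card Q = (\<Sum>l<M. card C * (\<delta> l + B))"
    unfolding Q_def by (subst card_SigmaI) (auto simp: card_cartesian_product)
  also have "\<dots> < p * B" using not_le by (simp add: \<delta>_eq B_def)
  finally have "card Q < card Z" by (simp add: Z_def)
  moreover have "finite Q" "finite Z" by (simp_all add: Q_def Z_def)
  ultimately obtain b where b: "\<exists>z\<in>Z. b z \<noteq> 0"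
    and b_eq: "\<And>x. x \<in> Q \<Longrightarrow> (\<Sum>z\<in>Z. b z * (\<lambda>(l, c, u). poly.coeff (q l c z) u) x) = 0"
    using homogeneous_system_solution[of Z Q "\<lambda>z (l, c, u). poly.coeff (q l c z) u"] by blast

  have deg_cf: "degree (cf l z) \<le> \<delta> l" for l z
    unfolding cf_def \<delta>_def
  proof (rule degree_iter_coeff)
    have "degree S = 2 * n" unfolding S_def by (simp add: degree_prod_linear)
    moreover have "lead_coeff S = 1" unfolding S_def by (rule lead_coeff_prod_linear)
    ultimately show "degree S \<le> Suc (2 * n - 1)" "poly.coeff S (Suc (2 * n - 1)) = 1"
      using two_le_n by (simp_all del: One_nat_def)
    show "degree (\<Lambda> z) \<le> 2 * n - 1"
      using degree_log_deriv_numerator[of "{..<2 * n}" conj_root "expo (slot z)"] by (simp add: \<Lambda>_def)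
    have "poly.coeff (\<Lambda> z) (2 * n - 1) = of_nat (n * (p - 1))"
      using coeff_log_deriv_numerator[of "{..<2 * n}" conj_root "expo (slot z)"]
      unfolding \<Lambda>_def sum_expo by simp
    thus "\<kappa> l = of_nat (top_digit 1 + (2 * n - 1 - 1) * l) + poly.coeff (\<Lambda> z) (2 * n - 1)" for l
      by (simp only: \<kappa>_def \<delta>_def)
    show "degree (g ^ offset z) \<le> top_digit 1"
      using offset_le[of z] by (simp add: g_def degree_power_eq)
  qed (use two_le_n in simp)
  have deg_q: "degree (q l c z) < \<delta> l + B" if "z \<in> Z" for l c z
  proof -
    have "z div p < B" using that by (simp add: Z_def less_mult_imp_div_less mult.commute)
    moreover have "degree (q l c z) \<le> degree (cf l z) + degree ([:\<alpha>, 1:] ^ (z div p)) + degree [:c ^ slot z:]"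
      unfolding q_def by (intro order_trans[OF degree_mult_le] add_right_mono degree_mult_le)
    ultimately show ?thesis using deg_cf[of l z] by (simp add: degree_power_eq)
  qed
  have q_sum: "(\<Sum>z\<in>Z. smult (b z) (q l c z)) = 0" if "l < M" "c \<in> C" for l c
  proof (rule poly_eqI)
    fix u
    show "poly.coeff (\<Sum>z\<in>Z. smult (b z) (q l c z)) u = poly.coeff 0 u"
    proof (cases "u < \<delta> l + B")
      case True
      hence "(l, c, u) \<in> Q" using that by (simp add: Q_def)
      from b_eq[OF this] show ?thesis by (simp add: coeff_sum)
    next
      case False
      have "poly.coeff (q l c z) u = 0" if "z \<in> Z" for z
        using deg_q[OF that, of l c] False by (intro coeff_eq_0) linarith
      thus ?thesis by (simp add: coeff_sum)
    qed
  qed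

  have iter: "iter_twisted S (2 * n - 1) \<kappa> l (basis_poly z) =
      cf l z * ((g ^ p) ^ (z div p) * char_poly (slot z))" for l z
  proof -
    let ?\<chi> = "(g ^ p) ^ (z div p) * char_poly (slot z)"
    have "pderiv ((g ^ p) ^ (z div p)) = 0"
      unfolding power_mult[symmetric] pderiv_power by (simp add: of_nat_eq_0_iff)
    hence "S * pderiv ?\<chi> = (g ^ p) ^ (z div p) * (S * pderiv (char_poly (slot z)))"
      by (simp add: pderiv_mult mult.left_commute)
    also have "S * pderiv (char_poly (slot z)) = \<Lambda> z * char_poly (slot z)"
      unfolding S_def char_poly_def \<Lambda>_def by (rule log_deriv_linear_product) simp
    finally have "S * pderiv ?\<chi> = \<Lambda> z * ?\<chi>" by (simp only: mult.left_commute)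
    from iter_twisted_mult[OF this] show ?thesis
      by (simp only: cf_def basis_poly_def g_def mult.assoc)
  qed
  define \<Psi> where "\<Psi> = (\<Sum>z\<in>Z. smult (b z) (basis_poly z))"
  have \<Psi>0: "\<Psi> \<noteq> 0"
    using b basis_poly_independent[of Z _ b] by (auto simp: \<Psi>_def Z_def)
  have zero: "poly (iter_twisted S (2 * n - 1) \<kappa> l \<Psi>) (of_nat t) = 0" if "l < M" for l t
  proof -
    define c where "c = ((of_nat t + \<alpha>) / (of_nat t + \<beta>)) ^ k"
    have frob: "(of_nat t + base_root) ^ p = of_nat t + \<alpha>"
      using frob_add[of "of_nat t" base_root 1] by (simp add: of_nat_frob base_root_frob)
    have eval: "poly (iter_twisted S (2 * n - 1) \<kappa> l (basis_poly z)) (of_nat t) =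
        poly (q l c z) (of_nat t)" for z
    proof -
      have "slot z \<le> d" using slot_mem[of z] by simp
      thus ?thesis unfolding iter
        by (simp add: q_def g_def poly_char_poly c_def frob add.commute)
    qed
    have "poly (iter_twisted S (2 * n - 1) \<kappa> l \<Psi>) (of_nat t) =
        poly (\<Sum>z\<in>Z. smult (b z) (q l c z)) (of_nat t)"
      unfolding \<Psi>_def iter_twisted_sum[OF \<open>finite Z\<close>] by (simp only: poly_sum poly_smult eval)
    thus ?thesis using q_sum[OF that C[of t]] by (simp add: c_def)
  qed
  have S_nonzero: "poly S (of_nat t) \<noteq> 0" for t
  proof -
    have "of_nat t + conj_root i \<noteq> 0" for i
      using prime_field_plus_\<alpha>[of t] prime_field_plus_\<beta>[of t]
      by (simp add: prime_field_plus_conj_root)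
    thus ?thesis by (simp add: S_def poly_prod prod_zero_iff add.commute)
  qed
  have order_M: "M \<le> Polynomial.order (of_nat t) \<Psi>" for t
    using iter_twisted_vanishing[OF Mp S_nonzero zero] \<Psi>0 by (simp add: order_divides)
  have "g ^ top_digit 1 dvd \<Psi>" unfolding \<Psi>_def
  proof (intro dvd_sum dvd_smult)
    fix z
    obtain \<omega> where "basis_poly z = g ^ (top_digit 1 + z) * \<omega>"
      using basis_poly_decomp[of z] unfolding g_def by blast
    thus "g ^ top_digit 1 dvd basis_poly z" by (simp add: power_add mult.assoc)
  qed
  hence order_base: "top_digit 1 \<le> Polynomial.order (- base_root) \<Psi>"
    using \<Psi>0 order_divides[of "- base_root" "top_digit 1" \<Psi>] by (simp add: g_def)
  define T where "T = (of_nat :: nat \<Rightarrow> 'a) ` {..<p}"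
  have "- base_root \<notin> T"
  proof
    assume "- base_root \<in> T"
    then obtain t where "- base_root = of_nat t" by (auto simp: T_def)
    hence "base_root = - of_nat t" by (metis minus_minus)
    hence "of_nat t + conj_root (n - 1) = 0" using two_le_n by (simp add: conj_root_def base_root_def)
    thus False using prime_field_plus_\<alpha>[of t] two_le_n
      by (simp add: prime_field_plus_conj_root)
  qed
  moreover have "p * M \<le> (\<Sum>x\<in>T. Polynomial.order x \<Psi>)"
  proof -
    have "card T * M \<le> (\<Sum>x\<in>T. Polynomial.order x \<Psi>)"
      using sum_bounded_below[of T M "\<lambda>x. Polynomial.order x \<Psi>"] order_M by (auto simp: T_def)
    thus ?thesis by (simp add: T_def card_image[OF inj_on_of_nat])
  qed
  ultimately have "top_digit 1 + p * M \<le> (\<Sum>x\<in>insert (- base_root) T. Polynomial.order x \<Psi>)"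
    using order_base by (simp add: T_def)
  also have "\<dots> \<le> degree \<Psi>" using \<Psi>0 by (rule sum_order_le) (simp add: T_def)
  also have "\<dots> \<le> top_digit 1 + p * (B - 1) + n * (p - 1)"
    unfolding \<Psi>_def
  proof (rule degree_sum_le)
    fix z assume "z \<in> Z"
    thus "degree (smult (b z) (basis_poly z)) \<le> top_digit 1 + p * (B - 1) + n * (p - 1)"
      using order_trans[OF degree_smult_le degree_basis_poly[of z B]] by (simp add: Z_def)
  qed (simp add: Z_def)
  finally have "p * M \<le> p * (M - n) + n * (p - 1)" by (simp add: B_def)
  also have "\<dots> < p * (M - n) + n * p" using two_le_n p_pos by simp
  also have "\<dots> = p * ((M - n) + n)" by (simp add: distrib_left)
  also have "\<dots> = p * M" using nM by simp
  finally show False by simp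
qed

text \<open>The order \<open>M\<close> is the integer part of \<open>sqrt (p / r)\<close>. The size
  of \<open>p\<close> ensures \<open>n \<le> M \<le> p\<close>, and \<open>stepanov_numeric\<close>
  refutes the inequality of \<open>stepanov_bound\<close>.\<close>

lemma stepanov_contradiction:
  assumes C: "\<And>t. ((of_nat t + \<alpha>) / (of_nat t + \<beta>)) ^ k \<in> C" and card_C: "card C \<le> r"
    and r: "1 \<le> r" "r < d"
    and large: "real p \<ge> (2 * real n - 1)\<^sup>2 * real r * (real d)\<^sup>2 / (real d - real r)\<^sup>2"
  shows False
proof -
  define P where "P = sqrt (real p / real r)"
  define M where "M = nat \<lfloor>P\<rfloor>"
  have P2: "P ^ 2 * real r = real p" using r by (simp add: P_def)
  have P0: "0 \<le> P" by (simp add: P_def)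
  have dr: "real d - real r > 0" using r by simp
  have "((2 * real n - 1) * real d / (real d - real r)) ^ 2 \<le> P ^ 2"
  proof -
    have "((2 * real n - 1) * real d / (real d - real r)) ^ 2 * real r \<le> P ^ 2 * real r"
      using large unfolding P2 by (simp add: power_divide power_mult_distrib mult_ac)
    thus ?thesis using r by simp
  qed
  hence P_ge: "(2 * real n - 1) * real d / (real d - real r) \<le> P" using P0 by (rule power2_le_imp_le)
  hence P_ge': "(2 * real n - 1) * real d \<le> P * (real d - real r)" using dr by (simp add: pos_divide_le_eq)
  have "P * (real d - real r) \<le> P * real d" using P0 r by (intro mult_left_mono) auto
  hence "(2 * real n - 1) * real d \<le> P * real d" using P_ge' by linarith
  hence P_n: "2 * real n - 1 \<le> P" using two_le_d by simp
  have M_le: "real M \<le> P" and M_gt: "P < real M + 1" using P0 by (auto simp: M_def)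
  have nM: "n \<le> M" using P_n M_gt two_le_n by linarith
  have "P \<le> real p"
  proof -
    have "P * 1 \<le> P * (P * real r)"
    proof (rule mult_left_mono[OF _ P0])
      have "1 * 1 \<le> P * real r" using P_n two_le_n r by (intro mult_mono) auto
      thus "1 \<le> P * real r" by simp
    qed
    thus ?thesis using P2 by (simp add: power2_eq_square mult.assoc)
  qed
  hence Mp: "M \<le> p" using M_le by linarith
  have sum_l: "(\<Sum>l<M. (2 * n - 2) * l) = (n - 1) * (M * (M - 1))"
  proof -
    have "(\<Sum>l<M. (2 * n - 2) * l) = (n - 1) * (2 * (\<Sum>l<M. l))"
    proof -
      have "(2 * n - 2) * l = (n - 1) * (2 * l)" for l by (simp add: diff_mult_distrib)
      thus ?thesis by (simp only: sum_distrib_left[symmetric])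
    qed
    also have "2 * (\<Sum>l<M. l) = M * (M - 1)"
    proof (induction M)
      case (Suc M)
      thus ?case by (cases M) (simp_all add: algebra_simps)
    qed simp
    finally show ?thesis .
  qed
  have "p * (M - n + 1) \<le> (\<Sum>l<M. card C * (top_digit 1 + (2 * n - 2) * l + (M - n + 1)))"
    by (rule stepanov_bound[OF C nM Mp])
  also have "\<dots> \<le> (\<Sum>l<M. r * (top_digit 1 + (2 * n - 2) * l + (M - n + 1)))"
    by (intro sum_mono mult_le_mono1 card_C)
  also have "\<dots> = r * (\<Sum>l<M. top_digit 1 + (2 * n - 2) * l + (M - n + 1))"
    by (rule sum_distrib_left[symmetric])
  also have "(\<Sum>l<M. top_digit 1 + (2 * n - 2) * l + (M - n + 1)) =
      M * top_digit 1 + (n - 1) * (M * (M - 1)) + M * (M - n + 1)"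
    unfolding sum.distrib sum_l by simp
  finally have "real (p * (M - n + 1)) \<le> real (r * (M * top_digit 1 + (n - 1) * (M * (M - 1)) + M * (M - n + 1)))"
    by (rule of_nat_mono)
  hence bound: "real p * (real M - real n + 1) \<le>
      real r * (real M * real (top_digit 1) + (real n - 1) * (real M * (real M - 1)) + real M * (real M - real n + 1))"
  proof -
    have "real (M - n + 1) = real M - real n + 1" "real (M - 1) = real M - 1" "real (n - 1) = real n - 1"
      using nM two_le_n by simp_all
    thus ?thesis using \<open>real (p * (M - n + 1)) \<le> _\<close> by (simp only: of_nat_mult of_nat_add)
  qed
  have "top_digit 1 * d < p"
  proof -
    have "p ^ (n - 1) * (top_digit 1 * d) \<le> k * d"
      by (simp add: top_digit_def)
    also have "\<dots> < p ^ (n - 1) * p" using dk card_split p_pos by (simp add: mult.commute)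
    finally show ?thesis by simp
  qed
  hence e: "real (top_digit 1) * real d < real p" by (metis of_nat_less_iff of_nat_mult)
  have M0: "real M > 0" using nM two_le_n by simp
  have r0: "real r > 0" using r by simp
  show False
    by (rule stepanov_numeric[OF P2 P_ge' _ _ M_le M_gt _ _ _ e bound])
      (use P_n two_le_n nM two_le_d r in auto)
qed

end

section \<open>Monomials\<close>

context prime_power_field
begin

text \<open>The translates of the kernel by \<open>i x0\<close> with \<open>i < p\<close> are
  disjoint, since \<open>G\<close> takes the distinct values \<open>i G(x0)\<close> on them.\<close>

lemma card_kernel_le:
  fixes G :: "'a \<Rightarrow> 'a"
  assumes add: "\<And>x y. G (x + y) = G x + G y" and "G x0 \<noteq> 0"
  shows "p * card {x. G x = 0} \<le> p ^ n"
proof -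
  let ?K = "{x. G x = 0}"
  have G0: "G 0 = 0" using add[of 0 0] by (metis add.right_neutral add_left_cancel)
  have mult: "G (of_nat i * x) = of_nat i * G x" for i x
    by (induction i) (simp_all add: G0 add distrib_right)
  have "inj_on (\<lambda>(i, y). of_nat i * x0 + y) ({..<p} \<times> ?K)"
  proof (rule inj_onI, safe)
    fix i j y z assume ij: "i < p" "j < p" and K: "G y = 0" "G z = 0"
      and eq: "of_nat i * x0 + y = of_nat j * x0 + z"
    from arg_cong[OF eq, of G] have "of_nat i * G x0 = of_nat j * G x0"
      by (simp add: add mult K)
    hence "of_nat i = (of_nat j :: 'a)" using assms(2) by simp
    thus "i = j" using inj_on_of_nat ij by (auto dest: inj_onD)
    thus "y = z" using eq by simp
  qed
  hence "card ({..<p} \<times> ?K) \<le> card (UNIV :: 'a set)" by (rule card_inj_on_le) auto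
  thus ?thesis by (simp add: card_cartesian_product card_field)
qed

lemma card_frob_fixed: "card {x :: 'a. x ^ (p ^ i) = x} \<le> p ^ i" if "0 < i"
proof -
  have p2: "2 \<le> p" using prime_p by (rule prime_ge_2_nat)
  hence "p ^ 1 \<le> p ^ i" using that by (intro power_increasing) auto
  hence pi: "2 \<le> p ^ i" using p2 by simp
  define P where "P = monom (1::'a) (p ^ i) - monom 1 1"
  have "poly.coeff P (p ^ i) = 1" using pi by (simp add: P_def)
  hence "P \<noteq> 0" by auto
  moreover have "degree P \<le> p ^ i" unfolding P_def
    by (rule degree_diff_le) (use pi in \<open>simp_all add: degree_monom_eq\<close>)
  moreover have "{x. poly P x = 0} = {x. x ^ (p ^ i) = x}" by (simp add: P_def poly_monom)
  ultimately show ?thesis using card_poly_roots_bound[of P] by simp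
qed

lemma frob_fixed_eq: "{x :: 'a. x ^ p = x} = range of_nat"
proof -
  have "(of_nat :: nat \<Rightarrow> 'a) ` {..<p} \<subseteq> {x. x ^ p = x}" by (auto simp: of_nat_frob)
  moreover have "card {x :: 'a. x ^ p = x} \<le> card ((of_nat :: nat \<Rightarrow> 'a) ` {..<p})"
    using card_frob_fixed[of 1] by (simp add: card_image[OF inj_on_of_nat])
  ultimately have "(of_nat :: nat \<Rightarrow> 'a) ` {..<p} = {x. x ^ p = x}" by (intro card_seteq) auto
  thus ?thesis by (auto simp: of_nat_frob)
qed

text \<open>
  The \<open>x\<close> violating the hypotheses of the Stepanov argument lie in the union of \<open>2 n - 1\<close>
  additive subgroups.  These cannot cover the field if they are proper.
\<close>

lemma exists_generic_point:
  fixes F :: "'a \<Rightarrow> 'a"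
  assumes add: "\<And>x y. F (x + y) = F x + F y" and inj: "inj F" and large: "2 * n - 1 < p"
    and not_frob: "\<And>i. i < n \<Longrightarrow> \<exists>x. F x \<noteq> x ^ (p ^ i)"
  obtains x where "\<And>i. 1 \<le> i \<Longrightarrow> i < n \<Longrightarrow> F x ^ (p ^ i) \<noteq> F x"
    and "\<And>i. i < n \<Longrightarrow> x ^ (p ^ i) \<noteq> F x"
proof (rule ccontr)
  assume "\<not> thesis"
  hence no: "\<not> ((\<forall>i. 1 \<le> i \<longrightarrow> i < n \<longrightarrow> F x ^ (p ^ i) \<noteq> F x) \<and> (\<forall>i<n. x ^ (p ^ i) \<noteq> F x))" for x
    using that by blast
  define A where "A i = {x. F x ^ (p ^ i) = F x}" for i
  define K where "K i = {x. F x - x ^ (p ^ i) = 0}" for i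
  have "x \<in> (\<Union>i\<in>{1..<n}. A i) \<union> (\<Union>i<n. K i)" for x
  proof -
    have "(\<exists>i. 1 \<le> i \<and> i < n \<and> F x ^ (p ^ i) = F x) \<or> (\<exists>i<n. F x = x ^ (p ^ i))"
      using no[of x] by metis
    thus ?thesis by (auto simp: A_def K_def)
  qed
  hence "(\<Union>i\<in>{1..<n}. A i) \<union> (\<Union>i<n. K i) = UNIV" by blast
  hence "p ^ n \<le> card ((\<Union>i\<in>{1..<n}. A i) \<union> (\<Union>i<n. K i))" by (simp flip: card_field)
  also have "\<dots> \<le> card (\<Union>i\<in>{1..<n}. A i) + card (\<Union>i<n. K i)" by (rule card_Un_le)
  also have "\<dots> \<le> (\<Sum>i\<in>{1..<n}. card (A i)) + (\<Sum>i<n. card (K i))"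
    by (intro add_mono card_UN_le) auto
  finally have le: "p ^ n \<le> (\<Sum>i\<in>{1..<n}. card (A i)) + (\<Sum>i<n. card (K i))" .
  \<comment> \<open>\<open>F\<close> maps \<open>A i\<close> injectively into the fixed points of
    the \<open>i\<close>-th power of Frobenius.\<close>
  have A: "p * card (A i) \<le> p ^ n" if "i \<in> {1..<n}" for i
  proof -
    have "card (A i) = card (F ` A i)" 
      by (rule card_image[OF inj_on_subset[OF inj subset_UNIV], symmetric])
    also have "\<dots> \<le> card {x :: 'a. x ^ (p ^ i) = x}" by (rule card_mono) (auto simp: A_def)
    also have "\<dots> \<le> p ^ i" by (rule card_frob_fixed) (use that in simp)
    finally have "p * card (A i) \<le> p ^ Suc i" by simp
    also have "\<dots> \<le> p ^ n" using that p_pos by (intro power_increasing) auto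
    finally show ?thesis .
  qed
  have K: "p * card (K i) \<le> p ^ n" if i: "i < n" for i
  proof -
    obtain x0 where "F x0 \<noteq> x0 ^ (p ^ i)" using not_frob[OF i] by blast
    thus ?thesis unfolding K_def
      by (intro card_kernel_le[of _ x0]) (simp_all add: add frob_add)
  qed
  have "p * p ^ n \<le> (\<Sum>i\<in>{1..<n}. p * card (A i)) + (\<Sum>i<n. p * card (K i))"
    using mult_le_mono2[OF le, of p] by (simp add: distrib_left sum_distrib_left)
  also have "\<dots> \<le> (\<Sum>i\<in>{1..<n}. p ^ n) + (\<Sum>i<n. p ^ n)"
    by (intro add_mono sum_mono A K) auto
  also have "\<dots> = (2 * n - 1) * p ^ n" using n_pos by (simp add: diff_mult_distrib)
  finally show False using large p_pos by simp
qed

end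

text \<open>Lagrange's theorem gives the order of \<open>H\<close>. Raising to the power
  \<open>card H\<close> is trivial on \<open>H\<close>, hence constant on each coset.\<close>

lemma union_of_cosets_power:
  fixes H D :: "'a::{field,finite} set"
  assumes H: "subgroup H mult_group" and index: "card (rcosets\<^bsub>mult_group\<^esub> H) = d"
    and D: "is_union_of_cosets mult_group r H D"
  shows "d * card H = CARD('a) - 1" and "0 \<notin> D" and "card ((\<lambda>x. x ^ card H) ` D) \<le> r"
proof -
  interpret G: group "mult_group :: 'a monoid" by (rule group_mult_group)
  have "card (rcosets\<^bsub>mult_group\<^esub> H) * card H = Coset.order (mult_group :: 'a monoid)"
    by (rule G.lagrange[OF H])
  thus "d * card H = CARD('a) - 1"
    by (simp add: index Coset.order_def mult_group_simps card_Diff_singleton)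
  have H0: "0 \<notin> H" using subgroup.subset[OF H] by (auto simp: mult_group_simps)
  have pow_H: "h ^ card H = 1" if h: "h \<in> H" for h
  proof -
    have h0: "h \<noteq> 0" using h H0 by auto
    have "(*) h ` H \<subseteq> H"
      using subgroup.m_closed[OF H h] by (auto simp: mult_group_simps)
    hence img: "(*) h ` H = H" using h0 by (intro card_subset_eq) (auto simp: card_image inj_on_def)
    have "(\<Prod>y\<in>H. y) = (\<Prod>y\<in>(*) h ` H. y)" by (simp only: img)
    also have "\<dots> = (\<Prod>y\<in>H. h * y)" using h0 by (subst prod.reindex) (auto simp: inj_on_def)
    also have "\<dots> = h ^ card H * (\<Prod>y\<in>H. y)" by (simp add: prod.distrib)
    finally have "(\<Prod>y\<in>H. y) = h ^ card H * (\<Prod>y\<in>H. y)" .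
    moreover have "(\<Prod>y\<in>H. y) \<noteq> 0" using H0 by (auto simp: prod_zero_iff)
    ultimately show ?thesis by simp
  qed
  obtain \<C> where \<C>: "\<C> \<subseteq> rcosets\<^bsub>mult_group\<^esub> H" "finite \<C>" "card \<C> = r" "D = \<Union>\<C>"
    using D by (auto simp: is_union_of_cosets_def)
  have coset: "\<exists>g. g \<noteq> 0 \<and> K = (\<lambda>h. h * g) ` H" if "K \<in> \<C>" for K
  proof -
    from that \<C>(1) obtain g where "g \<in> carrier mult_group" "K = H #>\<^bsub>mult_group\<^esub> g"
      unfolding RCOSETS_def by blast
    thus ?thesis by (intro exI[of _ g]) (auto simp: r_coset_def mult_group_simps)
  qed
  show "0 \<notin> D"
  proof
    assume "0 \<in> D"
    then obtain K where "K \<in> \<C>" "0 \<in> K" by (auto simp: \<C>(4))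
    thus False using coset[of K] H0 by auto
  qed
  have "card ((\<lambda>x. x ^ card H) ` K) \<le> 1" if K: "K \<in> \<C>" for K
  proof -
    obtain g where "K = (\<lambda>h. h * g) ` H" using coset[OF K] by blast
    hence "(\<lambda>x. x ^ card H) ` K \<subseteq> {g ^ card H}" by (auto simp: power_mult_distrib pow_H)
    from card_mono[OF _ this] show ?thesis by simp
  qed
  hence "(\<Sum>K\<in>\<C>. card ((\<lambda>x. x ^ card H) ` K)) \<le> (\<Sum>K\<in>\<C>. 1)" by (intro sum_mono)
  moreover have "card ((\<lambda>x. x ^ card H) ` D) \<le> (\<Sum>K\<in>\<C>. card ((\<lambda>x. x ^ card H) ` K))"
    unfolding \<C>(4) image_Union by (rule card_UN_le) (fact \<C>(2))
  ultimately show "card ((\<lambda>x. x ^ card H) ` D) \<le> r" using \<C>(3) by simp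
qed

theorem theorem1p4:
  fixes n d r p :: nat
    and H D :: "'a::{field,finite} set"
    and f :: "'a \<Rightarrow> 'a"
  assumes "n \<ge> 2" and "d \<ge> 2"
    and "1 \<le> r" and "r \<le> d - 1"
    and "prime p"
    and "CARD('a) = p ^ n"
    and "[p ^ n = 1] (mod d)"
    and "real p \<ge> (2 * real n - 1)\<^sup>2 * real r * (real d)\<^sup>2 / (real d - real r)\<^sup>2"
    and "subgroup H mult_group"
    and "card (rcosets\<^bsub>mult_group\<^esub> H) = d"
    and "is_union_of_cosets mult_group r H D"
    and "directions f \<subseteq> D"
    and "real (card (directions f)) \<le> (real CARD('a) + 1) / 2"
  shows "\<exists>a b. \<exists>j\<le>n - 1. \<forall>x. f x = a * x ^ (p ^ j) + b"
proof -
  have rd: "r < d" using assms(2,4) by linarith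
  have p_large: "(2 * real n - 1)\<^sup>2 \<le> real p"
  proof -
    have dr: "0 < real d - real r" using rd by simp
    have "(real d - real r)\<^sup>2 \<le> (real d)\<^sup>2" using dr by (intro power_mono) auto
    also have "\<dots> \<le> real r * (real d)\<^sup>2"
      using mult_right_mono[of 1 "real r" "(real d)\<^sup>2"] assms(3) by simp
    finally have "1 \<le> real r * (real d)\<^sup>2 / (real d - real r)\<^sup>2" using dr by (simp add: pos_le_divide_eq)
    hence "(2 * real n - 1)\<^sup>2 * 1 \<le> (2 * real n - 1)\<^sup>2 * (real r * (real d)\<^sup>2 / (real d - real r)\<^sup>2)"
      by (intro mult_left_mono) auto
    also have "\<dots> \<le> real p" using assms(8) by (simp add: mult.assoc)
    finally show ?thesis by simp
  qed
  have "3 * (2 * real n - 1) \<le> (2 * real n - 1)\<^sup>2"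
    unfolding power2_eq_square using assms(1) by (intro mult_right_mono) auto
  hence p_n: "3 * (2 * real n - 1) \<le> real p" using p_large by linarith
  have large: "2 * n - 1 < p"
  proof -
    have "2 \<le> real n" using assms(1) by simp
    hence "2 * real n < real p + 1" using p_n by argo
    hence "2 * n < p + 1" by linarith
    thus ?thesis using assms(1) by linarith
  qed
  have "odd p" using prime_odd_nat[OF assms(5)] large assms(1) by linarith
  moreover have "2 * card (directions f) \<le> p ^ n + 1"
  proof -
    have "real (2 * card (directions f)) \<le> real (p ^ n + 1)"
      using assms(13) by (simp add: assms(6))
    thus ?thesis by (simp only: of_nat_le_iff)
  qed
  ultimately interpret few_directions "TYPE('a)" p n f
    using assms(5,6) by unfold_locales

  note cosets = union_of_cosets_power[OF assms(9-11)]
  define a where "a = f 1 - f 0"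
  define F where "F x = (f x - f 0) / a" for x
  have slope: "(f x - f y) / (x - y) \<in> D" if "x \<noteq> y" for x y
    using that assms(12) by (auto simp: directions_def)
  \<comment> \<open>A repeated value of \<open>f\<close> would give the direction 0, which is not in
    \<open>D\<close>.\<close>
  have inj_f: "f x \<noteq> f y" if "x \<noteq> y" for x y using slope[OF that] cosets(2) by auto
  have a0: "a \<noteq> 0" using inj_f[of 1 0] by (simp add: a_def)
  have F_add: "F (x + y) = F x + F y" for x y
  proof -
    have "f (x + y) - f 0 = (f x - f 0) + (f y - f 0)"
      using affine_additive[of x y] by (simp add: algebra_simps)
    thus ?thesis by (simp only: F_def add_divide_distrib)
  qed
  have inj_F: "inj F" using inj_f a0 by (intro injI) (auto simp: F_def)
  have F_of_nat: "F (of_nat t) = of_nat t" for t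
  proof (induction t)
    case (Suc t)
    have "F 1 = 1" using a0 by (simp add: F_def a_def)
    thus ?case using Suc F_add[of 1 "of_nat t"] by simp
  qed (simp add: F_def)
  \<comment> \<open>Dividing \<open>f\<close> by \<open>a\<close> divides all slopes by
    \<open>a\<close>, so the slopes of \<open>F\<close> have at most \<open>r\<close> character
    values.\<close>
  define C where "C = (\<lambda>x. (x / a) ^ card H) ` D"
  have card_C: "card C \<le> r"
  proof -
    have "C = (\<lambda>c. c / a ^ card H) ` (\<lambda>x. x ^ card H) ` D"
      by (simp add: C_def image_image power_divide)
    hence "card C \<le> card ((\<lambda>x. x ^ card H) ` D)" by (simp add: card_image_le)
    thus ?thesis using cosets(3) by linarith
  qed
  have F_C: "(F x / x) ^ card H \<in> C" if "x \<noteq> 0" for x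
  proof -
    have "F x / x = (f x - f 0) / (x - 0) / a" by (simp add: F_def)
    thus ?thesis unfolding C_def by (simp only:) (rule imageI[OF slope[OF that]])
  qed

  have "\<exists>j<n. \<forall>x. F x = x ^ (p ^ j)"
  proof (rule ccontr)
    assume "\<not> ?thesis"
    hence "\<exists>x. F x \<noteq> x ^ (p ^ i)" if "i < n" for i using that by blast
    then obtain x where x: "\<And>i. 1 \<le> i \<Longrightarrow> i < n \<Longrightarrow> F x ^ (p ^ i) \<noteq> F x"
      "\<And>i. i < n \<Longrightarrow> x ^ (p ^ i) \<noteq> F x"
      using exists_generic_point[OF F_add inj_F large] by blast
    \<comment> \<open>\<open>F\<close> fixes the prime field pointwise, so there
      \<open>F x = x\<close>, contrary to the choice of \<open>x\<close>.\<close>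
    have "x ^ p \<noteq> x"
    proof
      assume "x ^ p = x"
      then obtain t where "x = of_nat t" using frob_fixed_eq by blast
      hence "F x = x" by (simp add: F_of_nat)
      thus False using x(2)[of 0] assms(1) by simp
    qed
    then interpret power_character "TYPE('a)" p n "F x" x "card H" d
      using assms(1,2) cosets(1) x card_field by unfold_locales auto
    \<comment> \<open>As \<open>F (t + x) = t + F x\<close>, this quotient is the slope of
      \<open>F\<close> between 0 and \<open>t + x\<close>.\<close>
    have "((of_nat t + F x) / (of_nat t + x)) ^ card H \<in> C" for t
      using F_C[of "of_nat t + x"] prime_field_plus_\<beta>[of t] by (simp add: F_add F_of_nat)
    thus False by (rule stepanov_contradiction[OF _ card_C assms(3) rd assms(8)])
  qed
  then obtain j where j: "j < n" "\<And>x. F x = x ^ (p ^ j)" by blast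
  have "f x = a * x ^ (p ^ j) + f 0" for x
    unfolding j(2)[symmetric] using a0 by (simp add: F_def)
  moreover have "j \<le> n - 1" using j(1) by linarith
  ultimately show ?thesis by blast
qed

end
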